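(* Let $r\ge 1$ and let $A,B,Q,R,P,K,F,G$ be as in the context. Suppose $F$ and $G$ are $\mathcal{C}^r$ and vanish together with their first derivatives at the origin, so that for every $\mathcal{C}^r$ function $\psi$ with $\psi(0)=0$ and $\frac{\partial\psi}{\partial x}(0)=0$ the nonlinear terms $f_\psi$, $h_\psi$ defined in the context are $\mathcal{C}^r$ near $(0,0)$ and satisfy $$f_\psi(0,0)=0,\quad h_\psi(0,0)=0,\quad \frac{\partial f_\psi}{\partial (x,x^+)}(0,0)=0,\quad \frac{\partial h_\psi}{\partial (x,x^+)}(0,0)=0 .$$ Suppose that $0\in\mathbb{R}^{2n}$ is a hyperbolic fixed point of the bidirectional dynamics $$\begin{bmatrix} x^+\\ z\end{bmatrix}=\begin{bmatrix} A+BK & 0\\ 0 & (A+BK)'\end{bmatrix}\begin{bmatrix} x\\ z^+\end{bmatrix}+\begin{bmatrix} f_\psi(x,x^+)\\ h_\psi(x,x^+)\end{bmatrix}.\qquad( * )$$ Then there exists a $\mathcal{C}^r$ function $\psi$, defined on a neighborhood of $0\in\mathbb{R}^n$ with values in $\mathbb{R}^n$ and satisfying $\psi(0)=0$ and $\frac{\partial \psi}{\partial x}(0)=0$, such that $z=\psi(x)$ is a local stable manifold around the fixed point $0$ for the dynamics $( * )$ (whose nonlinear terms $f_\psi,h_\psi$ are formed with this same $\psi$).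
   Context: A prime denotes transpose; $x=x_k$, $x^+=x_{k+1}$, $z=z_k$, $z^+=z_{k+1}$ (similarly for $\lambda$). Data: $A\in\mathbb{R}^{n\times n}$ has zero as an eigenvalue (so it is singular), $B\in\mathbb{R}^{n\times m}$, $Q\in\mathbb{R}^{n\times n}$ is symmetric with $Q\ge 0$, $R\in\mathbb{R}^{m\times m}$ is symmetric with $R>0$. The matrix $P$ is a symmetric nonnegative definite solution of the discrete-time algebraic Riccati equation $$P-A'PA+A'PB(B'PB+R)^{-1}B'PA-Q=0,$$ $K=-(B'PB+R)^{-1}B'PA$, and all eigenvalues of $A+BK$ lie strictly inside the unit circle (this is the hyperbolicity of the fixed point: the linear part of $( * )$ has the eigenvalues of $A+BK$ as its stable multipliers and their reciprocals, with $\infty$ as the reciprocal of $0$, as its unstable ones). The functions $F,G:\mathbb{R}^n\times\mathbb{R}^n\to\mathbb{R}^n$ are the nonlinear terms of the original bidirectional Hamiltonian dynamics $$x^+=Ax-BR^{-1}B'\lambda^+ +F(x,\lambda^+),\qquad \lambda=Qx+A'\lambda^+ +G(x,\lambda^+),$$ with $F(0,0)=0$, $G(0,0)=0$ and all first partial derivatives of $F,G$ zero at $(0,0)$. The system $( * )$ arises from these dynamics by looking for the stable manifold in the form $\lambda=Px+\psi(x)$ and setting $z=\lambda-Px$. For an $\mathbb{R}^n$-valued function $\psi$ defined near $0\in\mathbb{R}^n$, define $$f_\psi(x,x^+)=(I+BR^{-1}B'P)^{-1}\big(F(x,Px^+ +\psi(x^+))-BR^{-1}B'\psi(x^+)\big),$$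 $$g_\psi(x,x^+)=G(x,Px^+ +\psi(x^+))+K'B'\big(-\psi(x^+)-Pf_\psi(x,x^+)\big),$$ $$h_\psi(x,x^+)=(A+BK)'Pf_\psi(x,x^+)+g_\psi(x,x^+).$$ "$z=\psi(x)$ is a local stable manifold around $0$" for $( * )$ means: the graph of $\psi$ passes through $0$ and is locally invariant with trajectories on it converging to $0$; i.e. if $U$ denotes the domain of $\psi$, there is a neighborhood $V\subset U$ of $0$ such that for each $x_0\in V$ there is a sequence $(x_k)_{k\ge0}$ in $U$ starting at $x_0$ for which $(x_k,z_k)$ with $z_k=\psi(x_k)$ satisfies $$x_{k+1}=(A+BK)x_k+f_\psi(x_k,x_{k+1}),\qquad z_k=(A+BK)'z_{k+1}+h_\psi(x_k,x_{k+1})\quad\text{for all }k\ge 0,$$ and $(x_k,z_k)\to 0$ as $k\to\infty$. *)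

theory Defs
  imports "HOL-Analysis.Analysis"
begin

text \<open>
  \<open>Cr_on r S f\<close>: \<open>f\<close> is of class \<open>C\<^sup>r\<close> on the (open) set \<open>S\<close>. In finite dimension, continuity of
  \<open>x \<mapsto> D f(x)\<close> amounts to continuity of \<open>x \<mapsto> D f(x) v\<close> for every fixed \<open>v\<close>, so all directional
  derivatives are required to be \<open>r - 1\<close> times continuously differentiable.
\<close>
primrec Cr_on ::
  "nat \<Rightarrow> 'a::euclidean_space set \<Rightarrow> ('a \<Rightarrow> 'b::euclidean_space) \<Rightarrow> bool" where
  "Cr_on 0 S f \<longleftrightarrow> continuous_on S f"
| "Cr_on (Suc r) S f \<longleftrightarrow>
     (\<forall>x\<in>S. f differentiable (at x)) \<and>
     (\<forall>v. Cr_on r S (\<lambda>x. frechet_derivative f (at x) v))"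

definition eigenvalue :: "'a::field^'n^'n \<Rightarrow> 'a \<Rightarrow> bool" where
  "eigenvalue M \<mu> \<longleftrightarrow> (\<exists>v. v \<noteq> 0 \<and> M *v v = \<mu> *s v)"

text \<open>The eigenvalues of a real matrix are taken over the complex numbers.\<close>
definition eigenvalues_in_unit_disc :: "real^'n^'n \<Rightarrow> bool" where
  "eigenvalues_in_unit_disc M \<longleftrightarrow>
     (\<forall>\<mu>. eigenvalue (map_matrix complex_of_real M) \<mu> \<longrightarrow> cmod \<mu> < 1)"

definition symmetric_matrix :: "real^'n^'n \<Rightarrow> bool" where
  "symmetric_matrix M \<longleftrightarrow> transpose M = M"

definition nonneg_definite :: "real^'n^'n \<Rightarrow> bool" where
  "nonneg_definite M \<longleftrightarrow> (\<forall>x. 0 \<le> x \<bullet> (M *v x))"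

definition pos_definite :: "real^'n^'n \<Rightarrow> bool" where
  "pos_definite M \<longleftrightarrow> (\<forall>x. x \<noteq> 0 \<longrightarrow> 0 < x \<bullet> (M *v x))"

text \<open>
  In the nonlinear terms below the pair \<open>(x, y)\<close> stands for \<open>(x, x\<^sup>+)\<close>.
\<close>
definition f_term ::
  "real^'m^'n \<Rightarrow> real^'m^'m \<Rightarrow> real^'n^'n \<Rightarrow> ((real^'n) \<times> (real^'n) \<Rightarrow> real^'n) \<Rightarrow>
   (real^'n \<Rightarrow> real^'n) \<Rightarrow> (real^'n) \<times> (real^'n) \<Rightarrow> real^'n" where
  "f_term B R P F \<psi> = (\<lambda>(x, y).
     matrix_inv (mat 1 + B ** matrix_inv R ** transpose B ** P) *v
       (F (x, P *v y + \<psi> y) - (B ** matrix_inv R ** transpose B) *v \<psi> y))"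

definition g_term ::
  "real^'m^'n \<Rightarrow> real^'m^'m \<Rightarrow> real^'n^'n \<Rightarrow> real^'n^'m \<Rightarrow>
   ((real^'n) \<times> (real^'n) \<Rightarrow> real^'n) \<Rightarrow> ((real^'n) \<times> (real^'n) \<Rightarrow> real^'n) \<Rightarrow>
   (real^'n \<Rightarrow> real^'n) \<Rightarrow> (real^'n) \<times> (real^'n) \<Rightarrow> real^'n" where
  "g_term B R P K F G \<psi> = (\<lambda>(x, y).
     G (x, P *v y + \<psi> y) +
     (transpose K ** transpose B) *v (- \<psi> y - P *v f_term B R P F \<psi> (x, y)))"

definition h_term ::
  "real^'n^'n \<Rightarrow> real^'m^'n \<Rightarrow> real^'m^'m \<Rightarrow> real^'n^'n \<Rightarrow> real^'n^'m \<Rightarrow>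
   ((real^'n) \<times> (real^'n) \<Rightarrow> real^'n) \<Rightarrow> ((real^'n) \<times> (real^'n) \<Rightarrow> real^'n) \<Rightarrow>
   (real^'n \<Rightarrow> real^'n) \<Rightarrow> (real^'n) \<times> (real^'n) \<Rightarrow> real^'n" where
  "h_term A B R P K F G \<psi> = (\<lambda>(x, y).
     (transpose (A + B ** K) ** P) *v f_term B R P F \<psi> (x, y) + g_term B R P K F G \<psi> (x, y))"

text \<open>
  \<open>local_stable_manifold L f h U \<psi>\<close>: the graph of \<open>\<psi>\<close>, restricted to the neighborhood \<open>U\<close> of the
  origin on which \<open>\<psi>\<close> is regarded as defined, is a local stable manifold around \<open>0\<close> of the
  bidirectional dynamics \<open>x\<^sup>+ = L x + f(x, x\<^sup>+)\<close>, \<open>z = L' z\<^sup>+ + h(x, x\<^sup>+)\<close>. As \<open>L\<close> may be singular,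
  the second equation need not determine \<open>z\<^sup>+\<close>; the requirement is therefore the existence of a
  trajectory inside the graph.
\<close>
definition local_stable_manifold ::
  "real^'n^'n \<Rightarrow> ((real^'n) \<times> (real^'n) \<Rightarrow> real^'n) \<Rightarrow> ((real^'n) \<times> (real^'n) \<Rightarrow> real^'n) \<Rightarrow>
   (real^'n) set \<Rightarrow> (real^'n \<Rightarrow> real^'n) \<Rightarrow> bool" where
  "local_stable_manifold L f h U \<psi> \<longleftrightarrow>
     open U \<and> 0 \<in> U \<and> \<psi> 0 = 0 \<and>
     (\<exists>V. open V \<and> 0 \<in> V \<and> V \<subseteq> U \<and>
       (\<forall>x0\<in>V. \<exists>x :: nat \<Rightarrow> real^'n.
          x 0 = x0 \<and> (\<forall>k. x k \<in> U) \<and>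
          (\<forall>k. x (Suc k) = L *v x k + f (x k, x (Suc k)) \<and>
               \<psi> (x k) = transpose L *v \<psi> (x (Suc k)) + h (x k, x (Suc k))) \<and>
          (\<lambda>k. (x k, \<psi> (x k))) \<longlonglongrightarrow> (0, 0)))"

end

theory Submission
  imports Defs "HOL-Computational_Algebra.Fundamental_Theorem_Algebra"
begin

text \<open>
  The bidirectional dynamics says that \<open>x\<close> is propagated forwards by the stable matrix
  \<open>L = A + B K\<close> and \<open>z\<close> backwards by its transpose. As \<open>L\<close> may be singular, the dynamics is not the
  iteration of a local diffeomorphism, so the proof does not look for an invariant graph of a map:
  following Irwin, it solves for whole trajectories at once, in a Banach space of sequences.

  \<^bold>\<open>Reduction.\<close> Write \<open>S = B R\<^sup>-\<^sup>1 B'\<close>, \<open>M = (I + S P)\<^sup>-\<^sup>1\<close> and \<open>\<lambda>\<^sup>+ = P x\<^sup>+ + z\<^sup>+\<close>. The matrix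
  identity \<open>M S = B (B' P B + R)\<^sup>-\<^sup>1 B'\<close> (\<open>feedback_identities\<close>) makes all occurrences of
  \<open>\<psi>(x\<^sup>+)\<close> outside \<open>F\<close> and \<open>G\<close> cancel in \<open>h\<^sub>\<psi>\<close>, and what remains is
  \<open>x\<^sup>+ = L x + M F(x, \<lambda>\<^sup>+) - M S z\<^sup>+\<close> and \<open>z = L' z\<^sup>+ + A' P M F(x, \<lambda>\<^sup>+) + G(x, \<lambda>\<^sup>+)\<close>.
  Apart from the linear coupling \<open>M S z\<^sup>+\<close>, which is triangular and therefore harmless, all coupling
  is through \<open>\<phi> = (F, G)\<close>, whose derivative vanishes at the origin.

  \<^bold>\<open>Solving for trajectories.\<close> Let \<open>y\<^sub>k = (x\<^sub>k, \<lambda>\<^bsub>k+1\<^esub>)\<close>. If the values \<open>c\<^sub>k = \<phi>(y\<^sub>k)\<close> were known, the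
  bounded solution with \<open>x\<^sub>0 = p\<close> would be explicit: \<open>z\<close> is a backward sum, \<open>x\<close> a forward sum of
  powers of \<open>L\<close>. Both sums converge because \<open>\<Sum>\<^sub>k \<parallel>L\<^sup>k\<parallel> < \<infinity>\<close> (\<open>summable_powers_matrix\<close>). Hence bounded
  trajectories are the solutions of a fixed point equation \<open>y = \<L> p + \<G> (\<phi> \<circ> y)\<close> with bounded linear
  \<open>\<L>\<close>, \<open>\<G>\<close>, which is a contraction near \<open>0\<close>. It has a unique small solution \<open>u(p)\<close> for small \<open>p\<close>
  (\<open>solution_map\<close>), and \<open>\<psi>(p)\<close> is the initial value \<open>z\<^sub>0\<close> belonging to \<open>u(p)\<close>.

  \<^bold>\<open>Smoothness.\<close> Composition with a \<open>C\<^sup>r\<close> map acts as a \<open>C\<^sup>r\<close> map on bounded sequences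
  (\<open>superpose_has_derivative\<close>, \<open>Ck_on_superpose\<close>). A fixed point of a differentiable contraction
  depends differentiably on the parameter, and its derivative solves a linear fixed point equation
  (\<open>fixed_point_has_derivative\<close>); if the coefficients of that equation are \<open>C\<^sup>k\<close>, so is its solution
  (\<open>linear_fixed_point_Ck\<close>). The coefficients are made from \<open>u\<close> and the first derivatives of \<open>\<phi>\<close>, so
  the smoothness of \<open>u\<close> climbs from \<open>C\<^sup>k\<close> to \<open>C\<^bsup>k+1\<^esup>\<close> until \<open>r\<close> is reached.

  \<^bold>\<open>Invariance and convergence.\<close> Dropping the first entry of a small trajectory gives a small
  trajectory, which by uniqueness is the one starting at \<open>x\<^sub>1\<close>; so \<open>z\<^sub>k = \<psi>(x\<^sub>k)\<close> for all \<open>k\<close>. Since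
  \<open>\<parallel>L\<^sup>m\<parallel> \<le> 1/4\<close> for some \<open>m\<close> and the nonlinear part is small, \<open>\<parallel>x\<^bsub>k+m\<^esub>\<parallel> \<le> \<parallel>x\<^sub>k\<parallel> / 2\<close>, and the
  trajectory tends to \<open>0\<close> (\<open>stable_manifold_of_split_system\<close>).
\<close>

section \<open>Functions of class \<open>C\<^sup>k\<close> with values in a normed space\<close>

text \<open>
  The recursion of \<open>Cr_on\<close> for values in an arbitrary normed space, because the solution map takes values
  in a space of sequences. The domain stays finite-dimensional, so directional derivatives still
  capture continuous differentiability; and as they have the same type as the function itself,
  the order of smoothness is accessible to induction.
\<close>
primrec Ck_on ::
  "nat \<Rightarrow> 'a::euclidean_space set \<Rightarrow> ('a \<Rightarrow> 'b::real_normed_vector) \<Rightarrow> bool" where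
  "Ck_on 0 S f \<longleftrightarrow> continuous_on S f"
| "Ck_on (Suc r) S f \<longleftrightarrow>
     (\<forall>x\<in>S. f differentiable (at x)) \<and>
     (\<forall>v. Ck_on r S (\<lambda>x. frechet_derivative f (at x) v))"

lemma Cr_on_eq_Ck_on: "Cr_on r S f = Ck_on r S f"
  by (induction r arbitrary: f) simp_all

lemma Ck_on_cong:
  assumes "open S" and "\<And>x. x \<in> S \<Longrightarrow> f x = g x"
  shows "Ck_on r S f = Ck_on r S g"
  using assms(2)
proof (induction r arbitrary: f g)
  case 0
  then show ?case by (simp cong: continuous_on_cong)
next
  case (Suc r)
  have diff: "f differentiable (at x) \<longleftrightarrow> g differentiable (at x)" if "x \<in> S" for x
    unfolding differentiable_def
    using has_derivative_transform_within_open[OF _ assms(1) that] Suc.prems by metis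
  have fd: "frechet_derivative f (at x) = frechet_derivative g (at x)"
    if "x \<in> S" "f differentiable (at x)" for x
    using frechet_derivative_transform_within_open[OF that(2) assms(1) that(1)] Suc.prems by blast
  show ?case
  proof (cases "\<forall>x\<in>S. f differentiable (at x)")
    case True
    have "Ck_on r S (\<lambda>x. frechet_derivative f (at x) v)
        = Ck_on r S (\<lambda>x. frechet_derivative g (at x) v)" for v
      by (rule Suc.IH) (use True fd in simp)
    then show ?thesis using diff by simp
  qed (use diff in auto)
qed

text \<open>
  Any pointwise description \<open>f'\<close> of the derivative on the open set may replace the choice made by
  \<open>frechet_derivative\<close>; every smoothness proof below works with such an explicit derivative.
\<close>
lemma Ck_on_SucI:
  assumes "open S" and "\<And>x. x \<in> S \<Longrightarrow> (f has_derivative f' x) (at x)"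
    and "\<And>v. Ck_on r S (\<lambda>x. f' x v)"
  shows "Ck_on (Suc r) S f"
proof -
  have "Ck_on r S (\<lambda>x. frechet_derivative f (at x) v)" for v
    using assms(3)[of v] frechet_derivative_at[OF assms(2)]
    by (subst Ck_on_cong[OF assms(1), where g = "\<lambda>x. f' x v"]) auto
  then show ?thesis using assms(2) by (auto simp: differentiable_def)
qed

lemma Ck_on_SucE:
  assumes "Ck_on (Suc r) S f"
  obtains f' where "\<And>x. x \<in> S \<Longrightarrow> (f has_derivative f' x) (at x)"
    and "\<And>v. Ck_on r S (\<lambda>x. f' x v)"
  using assms that[of "\<lambda>x. frechet_derivative f (at x)"]
  by (auto simp: frechet_derivative_works)

lemma Ck_on_UNIV_SucE:
  assumes "Ck_on (Suc r) UNIV f"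
  obtains f' where "\<And>x. (f has_derivative f' x) (at x)" and "\<And>v. Ck_on r UNIV (\<lambda>x. f' x v)"
  using assms that[of "\<lambda>x. frechet_derivative f (at x)"]
  by (auto simp: frechet_derivative_works)

lemma Ck_on_continuous_on: "Ck_on r S f \<Longrightarrow> continuous_on S f"
  by (cases r) (auto intro!: continuous_at_imp_continuous_on differentiable_imp_continuous_within)

lemma Ck_on_Suc_imp: "Ck_on (Suc r) S f \<Longrightarrow> Ck_on r S f"
proof (induction r arbitrary: f)
  case 0
  then show ?case using Ck_on_continuous_on[OF 0] by simp
next
  case (Suc r)
  then show ?case by (metis Ck_on.simps(2))
qed

lemma Ck_on_subset: "Ck_on r S f \<Longrightarrow> T \<subseteq> S \<Longrightarrow> Ck_on r T f"
  by (induction r arbitrary: f) (auto intro: continuous_on_subset)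

lemma Ck_on_const: "Ck_on r S (\<lambda>x. c)"
  by (induction r arbitrary: c) auto

lemma Ck_on_linear_compose:
  assumes "bounded_linear l" "open S" "Ck_on r S f"
  shows "Ck_on r S (\<lambda>x. l (f x))"
  using assms(3)
proof (induction r arbitrary: f)
  case 0
  then show ?case using assms(1) by (simp add: linear_continuous_on_compose bounded_linear.linear)
      (metis bounded_linear.continuous_on)
next
  case (Suc r)
  obtain f' where f': "\<And>x. x \<in> S \<Longrightarrow> (f has_derivative f' x) (at x)"
    "\<And>v. Ck_on r S (\<lambda>x. f' x v)" using Ck_on_SucE[OF Suc.prems] by blast
  show ?case
    by (rule Ck_on_SucI[where f' = "\<lambda>x v. l (f' x v)"])
      (auto intro!: assms Suc.IH f' bounded_linear.has_derivative[OF assms(1)])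
qed

lemma Ck_on_add:
  assumes "open S" "Ck_on r S f" "Ck_on r S g"
  shows "Ck_on r S (\<lambda>x. f x + g x)"
  using assms(2,3)
proof (induction r arbitrary: f g)
  case 0
  then show ?case by (simp add: continuous_on_add)
next
  case (Suc r)
  obtain f' where f': "\<And>x. x \<in> S \<Longrightarrow> (f has_derivative f' x) (at x)"
    "\<And>v. Ck_on r S (\<lambda>x. f' x v)" using Ck_on_SucE[OF Suc.prems(1)] by blast
  obtain g' where g': "\<And>x. x \<in> S \<Longrightarrow> (g has_derivative g' x) (at x)"
    "\<And>v. Ck_on r S (\<lambda>x. g' x v)" using Ck_on_SucE[OF Suc.prems(2)] by blast
  show ?case
    by (rule Ck_on_SucI[where f' = "\<lambda>x v. f' x v + g' x v"])
      (auto intro!: assms Suc.IH f' g' has_derivative_add)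
qed

lemma Ck_on_sum:
  assumes "open S" "\<And>i. i \<in> I \<Longrightarrow> Ck_on r S (f i)"
  shows "Ck_on r S (\<lambda>x. \<Sum>i\<in>I. f i x)"
  using assms(2) by (induction I rule: infinite_finite_induct) (auto intro: assms(1) Ck_on_add Ck_on_const)

text \<open>
  Induction on \<open>r\<close> by the product rule: both summands of the derivative are again bilinear
  expressions in functions that are one order smoother than required.
\<close>
lemma Ck_on_bilinear:
  assumes "bounded_bilinear \<beta>" "open S" "Ck_on r S f" "Ck_on r S g"
  shows "Ck_on r S (\<lambda>x. \<beta> (f x) (g x))"
  using assms(3,4)
proof (induction r arbitrary: f g)
  case 0
  then show ?case using bounded_bilinear.continuous_on[OF assms(1)] by simp
next
  case (Suc r)
  obtain f' where f': "\<And>x. x \<in> S \<Longrightarrow> (f has_derivative f' x) (at x)"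
    "\<And>v. Ck_on r S (\<lambda>x. f' x v)" using Ck_on_SucE[OF Suc.prems(1)] by blast
  obtain g' where g': "\<And>x. x \<in> S \<Longrightarrow> (g has_derivative g' x) (at x)"
    "\<And>v. Ck_on r S (\<lambda>x. g' x v)" using Ck_on_SucE[OF Suc.prems(2)] by blast
  show ?case
    by (rule Ck_on_SucI[where f' = "\<lambda>x v. \<beta> (f x) (g' x v) + \<beta> (f' x v) (g x)"])
      (use Ck_on_Suc_imp[OF Suc.prems(1)] Ck_on_Suc_imp[OF Suc.prems(2)] in \<open>auto intro!:
         assms(2) Suc.IH f' g' Ck_on_add bounded_bilinear.FDERIV[OF assms(1)]\<close>)
qed

lemma Ck_on_bounded_linear: "bounded_linear l \<Longrightarrow> Ck_on r S l"
  using Ck_on_SucI[of UNIV l "\<lambda>x. l" r]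
  by (metis Ck_on_Suc_imp Ck_on_const Ck_on_subset bounded_linear_imp_has_derivative open_UNIV subset_UNIV)

lemma Ck_on_Pair:
  fixes f :: "'p::euclidean_space \<Rightarrow> 'a::real_normed_vector" and g :: "'p \<Rightarrow> 'b::real_normed_vector"
  assumes "open S" "Ck_on r S f" "Ck_on r S g"
  shows "Ck_on r S (\<lambda>x. (f x, g x))"
proof -
  have "Ck_on r S (\<lambda>x. (f x, 0) + (0, g x))"
    by (intro Ck_on_add assms Ck_on_linear_compose[of "\<lambda>a. (a, 0)"] Ck_on_linear_compose[of "\<lambda>b. (0, b)"]
        bounded_linear_Pair bounded_linear_ident bounded_linear_zero)
  then show ?thesis by simp
qed

text \<open>
  Precomposition with a linear map suffices here for functions defined only on an open set: a function
  of \<open>x\<^sup>+\<close> alone is regarded as a function of the pair \<open>(x, x\<^sup>+)\<close>.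
\<close>
lemma Ck_on_precompose_linear:
  fixes \<phi> :: "'a::euclidean_space \<Rightarrow> 'b::real_normed_vector" and l :: "'p::euclidean_space \<Rightarrow> 'a"
  assumes "open U" "Ck_on r U \<phi>" "bounded_linear l"
  shows "Ck_on r (l -` U) (\<lambda>p. \<phi> (l p))"
proof -
  have cont: "continuous_on UNIV l" by (rule linear_continuous_on[OF assms(3)])
  have o: "open (l -` U)" using cont assms(1) by (simp add: continuous_on_open_vimage)
  show ?thesis using assms(2)
  proof (induction r arbitrary: \<phi>)
    case 0
    then show ?case
      using continuous_on_compose2[of U \<phi> "l -` U" l] continuous_on_subset[OF cont] by auto
  next
    case (Suc r)
    obtain \<phi>' where \<phi>': "\<And>x. x \<in> U \<Longrightarrow> (\<phi> has_derivative \<phi>' x) (at x)"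
      "\<And>v. Ck_on r U (\<lambda>x. \<phi>' x v)" using Ck_on_SucE[OF Suc.prems] by blast
    show ?case
    proof (rule Ck_on_SucI[OF o])
      show "((\<lambda>p. \<phi> (l p)) has_derivative (\<lambda>v. \<phi>' (l p) (l v))) (at p)" if "p \<in> l -` U" for p
        using diff_chain_at[OF bounded_linear_imp_has_derivative[OF assms(3)], of \<phi> "\<phi>' (l p)" p] \<phi>'(1)[of "l p"] that
        by (simp add: o_def)
      show "Ck_on r (l -` U) (\<lambda>p. \<phi>' (l p) (l v))" for v by (rule Suc.IH[OF \<phi>'(2)])
    qed
  qed
qed

section \<open>Fixed points depending on a parameter\<close>

text \<open>
  The contraction principle for an affine map. The space in view is that of bounded sequences, whose
  completeness is \<open>complete_UNIV_bseq\<close> below.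
\<close>
lemma solve_contraction:
  fixes T :: "'x::real_normed_vector \<Rightarrow> 'x"
  assumes "complete (UNIV :: 'x set)" "bounded_linear T" "\<And>x. norm (T x) \<le> norm x / 2"
  shows "\<exists>!x. x = a + T x"
proof -
  interpret bounded_linear T by fact
  have "\<exists>!x\<in>UNIV. a + T x = x"
    by (rule Banach_fix[of _ "1/2"]) (use assms(1,3) in \<open>auto simp: dist_norm simp flip: diff\<close>)
  then show ?thesis by (metis (no_types) UNIV_I)
qed

text \<open>
  Implicit differentiation. With \<open>h = q - p\<close> and \<open>w = u q - u p\<close>, differentiability of \<open>\<Gamma>\<close> gives
  \<open>w = b h + T w + o(\<bar>h\<bar> + \<bar>w\<bar>)\<close>. As \<open>T\<close> is a contraction, this bounds \<open>w\<close> by a multiple of \<open>h\<close>, and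
  subtracting \<open>u' h = b h + T (u' h)\<close> leaves an error of order \<open>o(\<bar>h\<bar>)\<close>.
\<close>
lemma fixed_point_has_derivative:
  fixes \<Gamma> :: "'p::real_normed_vector \<Rightarrow> 'x::real_normed_vector \<Rightarrow> 'x"
  assumes complete: "complete (UNIV :: 'x set)"
    and D: "((\<lambda>(q, x). \<Gamma> q x) has_derivative (\<lambda>(h, w). b h + T w)) (at (p, u p))"
    and b: "bounded_linear b" and T: "bounded_linear T" "\<And>w. norm (T w) \<le> norm w / 2"
    and S: "open S" "p \<in> S" and fixp: "\<And>q. q \<in> S \<Longrightarrow> u q = \<Gamma> q (u q)"
    and cont: "isCont u p"
  obtains u' where "(u has_derivative u') (at p)" "\<And>h. u' h = b h + T (u' h)"
proof -
  define u' where "u' h = (THE w. w = b h + T w)" for h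
  have u': "u' h = b h + T (u' h)" for h
    unfolding u'_def by (rule theI'[OF solve_contraction[OF complete T]])
  have u'_unique: "w = u' h" if "w = b h + T w" for w h
    using solve_contraction[OF complete T, of "b h"] u' that by blast
  interpret b: bounded_linear b by fact
  interpret T: bounded_linear T by fact
  have add: "u' (g + h) = u' g + u' h" for g h
  proof (rule u'_unique[symmetric])
    show "u' g + u' h = b (g + h) + T (u' g + u' h)"
      using u'[of g] u'[of h] by (metis (no_types, lifting) T.add ab_semigroup_add_class.add_ac(1) add.left_commute b.add)
  qed
  have scale: "u' (c *\<^sub>R h) = c *\<^sub>R u' h" for c h
  proof (rule u'_unique[symmetric])
    show "c *\<^sub>R u' h = b (c *\<^sub>R h) + T (c *\<^sub>R u' h)"
      using u'[of h] by (metis T.scaleR b.scaleR scaleR_right_distrib)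
  qed
  obtain C where C: "0 < C" "\<And>h. norm (b h) \<le> norm h * C"
    using b.pos_bounded by blast
  have u'_bound: "norm (u' h) \<le> norm h * (2 * C)" for h
    using norm_triangle_ineq[of "b h" "T (u' h)"] u'[of h] T(2)[of "u' h"] C(2)[of h] by simp
  have bl: "bounded_linear u'"
    by (rule bounded_linear_intro[OF add scale u'_bound])
  have lim: "\<exists>d>0. \<forall>q. norm (q - p) < d \<longrightarrow> norm (u q - u p - u' (q - p)) \<le> e * norm (q - p)"
    if e: "e > 0" for e
  proof -
    \<comment> \<open>Below \<open>1/4\<close> the error is absorbed in the a priori bound; the other term is fitted to the final estimate.\<close>
    define e1 where "e1 = min (1/4) (e / (2 * (2 + 4 * C)))"
    have e1: "0 < e1" "e1 \<le> 1/4" "e1 \<le> e / (2 * (2 + 4 * C))"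
      using e C(1) unfolding e1_def by (simp_all only: min.cobounded1 min.cobounded2) auto
    from D[unfolded has_derivative_at_alt] e1(1) obtain d1 where d1: "d1 > 0"
      "\<And>y. norm (y - (p, u p)) < d1 \<Longrightarrow>
        norm ((\<lambda>(q, x). \<Gamma> q x) y - (\<lambda>(q, x). \<Gamma> q x) (p, u p) - (\<lambda>(h, w). b h + T w) (y - (p, u p)))
          \<le> e1 * norm (y - (p, u p))" by blast
    obtain d2 where d2: "d2 > 0" "\<And>q. norm (q - p) < d2 \<Longrightarrow> norm (u q - u p) < d1 / 2"
      using cont d1(1) unfolding continuous_at_eps_delta dist_norm by (meson half_gt_zero)
    obtain d3 where d3: "d3 > 0" "\<And>q. norm (q - p) < d3 \<Longrightarrow> q \<in> S"
      using S unfolding open_dist dist_norm by blast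
    define d where "d = min (d1/2) (min d2 d3)"
    show ?thesis
    proof (intro exI[of _ d] conjI allI impI)
      show "d > 0" using d1 d2 d3 by (auto simp: d_def)
      fix q assume q: "norm (q - p) < d"
      let ?h = "q - p" and ?w = "u q - u p"
      have n: "norm ((q, u q) - (p, u p)) \<le> norm ?h + norm ?w"
        using norm_Pair_le[of ?h ?w] by simp
      have w: "norm ?w < d1 / 2" using d2(2) q by (simp add: d_def)
      have "norm ((q, u q) - (p, u p)) < d1" using n w q by (simp add: d_def)
      from d1(2)[OF this] have "norm (\<Gamma> q (u q) - \<Gamma> p (u p) - (b ?h + T ?w)) \<le> e1 * (norm ?h + norm ?w)"
        using n e1(1) by simp (meson mult_left_mono order_trans less_imp_le)
      then have err: "norm (?w - (b ?h + T ?w)) \<le> e1 * (norm ?h + norm ?w)"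
        using fixp[of q] fixp[OF S(2)] d3(2)[of q] q by (simp add: d_def)
      \<comment> \<open>A priori bound: the increment of \<open>u\<close> is at most proportional to that of the parameter.\<close>
      have "norm ?w \<le> norm (?w - (b ?h + T ?w)) + (norm (b ?h) + norm (T ?w))"
        by (metis (no_types) add.commute diff_add_cancel norm_triangle_ineq norm_triangle_mono order_refl)
      also have "\<dots> \<le> (1/4) * (norm ?h + norm ?w) + (norm ?h * C + norm ?w / 2)"
        using err e1(2) C(2)[of ?h] T(2)[of ?w] mult_right_mono[OF e1(2) add_nonneg_nonneg[OF norm_ge_zero norm_ge_zero], of ?h ?w]
        by linarith
      finally have w2: "norm ?w \<le> (4 * C + 1) * norm ?h" by (simp add: algebra_simps)
      let ?d = "?w - u' ?h"
      have "?d = (?w - (b ?h + T ?w)) + T ?d"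
      proof -
        have "w - u = (w - (c + s)) + (s - t)" if "u = c + t" for w u c s t :: 'x
          using that by (simp add: algebra_simps)
        from this[OF u'[of ?h]] show ?thesis unfolding T.diff[of ?w "u' ?h"] .
      qed
      then have "norm ?d \<le> norm (?w - (b ?h + T ?w)) + norm ?d / 2"
        by (metis T(2) norm_triangle_mono order_refl)
      then have "norm ?d \<le> 2 * e1 * (norm ?h + norm ?w)" using err by simp
      also have "\<dots> \<le> 2 * e1 * ((2 + 4 * C) * norm ?h)"
        using w2 e1(1) by (intro mult_left_mono) (auto simp: algebra_simps intro: order_trans)
      also have "\<dots> = (e1 * (2 * (2 + 4 * C))) * norm ?h" by simp
      also have "\<dots> \<le> e * norm ?h"
        using e1(3) C(1) by (intro mult_right_mono) (auto simp: field_simps)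
      finally show "norm (u q - u p - u' (q - p)) \<le> e * norm (q - p)" .
    qed
  qed
  have "(u has_derivative u') (at p)"
    unfolding has_derivative_at_alt using bl lim by blast
  with u' that show ?thesis by blast
qed

text \<open>
  Induction on \<open>k\<close>. Differentiating \<open>w = b + \<Sum>\<^sub>i \<beta>\<^sub>i(w, c\<^sub>i)\<close> shows that the derivative of \<open>w\<close> in a fixed direction
  solves an equation with the same coefficients and with the inhomogeneity
  \<open>b' + \<Sum>\<^sub>i \<beta>\<^sub>i(w, c\<^sub>i')\<close>, which loses only one order, since \<open>w\<close> has by then been
  shown to be that smooth. Writing the linear part as a sum of bilinear maps avoids
  operator-valued functions.
\<close>
lemma linear_fixed_point_Ck:
  fixes w :: "'p::euclidean_space \<Rightarrow> 'x::real_normed_vector"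
    and \<beta> :: "'i \<Rightarrow> 'x \<Rightarrow> 'c::real_normed_vector \<Rightarrow> 'x"
  assumes complete: "complete (UNIV :: 'x set)" and S: "open S"
    and bil: "\<And>i. i \<in> I \<Longrightarrow> bounded_bilinear (\<beta> i)"
    and contr: "\<And>p x. p \<in> S \<Longrightarrow> norm (\<Sum>i\<in>I. \<beta> i x (c i p)) \<le> norm x / 2"
    and c: "\<And>i. i \<in> I \<Longrightarrow> Ck_on k S (c i)" and b: "Ck_on k S b"
    and eq: "\<And>p. p \<in> S \<Longrightarrow> w p = b p + (\<Sum>i\<in>I. \<beta> i (w p) (c i p))"
  shows "Ck_on k S w"
  using c b eq
proof (induction k arbitrary: b w)
  case 0
  have "isCont w p" if p: "p \<in> S" for p
  proof -
    define g where "g q = b q + (\<Sum>i\<in>I. \<beta> i (w p) (c i q))" for q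
    have "Ck_on 0 S g" unfolding g_def
      by (intro Ck_on_add S 0 Ck_on_sum Ck_on_bilinear[OF bil] Ck_on_const)
    then have "isCont g p" using p S by (simp add: continuous_on_eq_continuous_at)
    then have lim: "((\<lambda>q. 2 * norm (g q - g p)) \<longlongrightarrow> 0) (at p)"
      by (simp add: isCont_def LIM_zero_iff tendsto_mult_right_zero tendsto_norm_zero)
    have "((\<lambda>q. w q - w p) \<longlongrightarrow> 0) (at p)"
    proof (rule Lim_null_comparison[OF _ lim])
      have "norm (w q - w p) \<le> 2 * norm (g q - g p)" if q: "q \<in> S" for q
      proof -
        have "w q - w p = (g q - g p) + (\<Sum>i\<in>I. \<beta> i (w q - w p) (c i q))"
          using 0(3)[OF q] 0(3)[OF p]
          by (simp add: g_def bounded_bilinear.diff_left[OF bil] sum_subtractf)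
        then have "norm (w q - w p) \<le> norm (g q - g p) + norm (w q - w p) / 2"
          by (metis contr[OF q] norm_triangle_mono order_refl)
        then show ?thesis by simp
      qed
      then show "\<forall>\<^sub>F q in at p. norm (w q - w p) \<le> 2 * norm (g q - g p)"
        using S p by (metis (mono_tags, lifting) eventually_at_topological)
    qed
    then show ?thesis by (simp add: isCont_def LIM_zero_iff)
  qed
  then show ?case by (simp add: continuous_at_imp_continuous_on)
next
  case (Suc k)
  have c0: "Ck_on k S (c i)" if "i \<in> I" for i using Suc.prems(1) that Ck_on_Suc_imp by blast
  have w0: "Ck_on k S w"
    by (rule Suc.IH[OF _ _ Suc.prems(3)]) (use c0 Ck_on_Suc_imp[OF Suc.prems(2)] in auto)
  obtain b' where b': "\<And>x. x \<in> S \<Longrightarrow> (b has_derivative b' x) (at x)"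
    "\<And>v. Ck_on k S (\<lambda>x. b' x v)" using Ck_on_SucE[OF Suc.prems(2)] by blast
  define c' where "c' i x = frechet_derivative (c i) (at x)" for i x
  have c': "(c i has_derivative c' i x) (at x)" if "x \<in> S" "i \<in> I" for x i
    using Suc.prems(1)[OF that(2)] that(1) unfolding c'_def by (simp add: frechet_derivative_works)
  have c'k: "Ck_on k S (\<lambda>x. c' i x v)" if "i \<in> I" for i v
    using Suc.prems(1)[OF that] unfolding c'_def by simp
  define b1 where "b1 p v = b' p v + (\<Sum>i\<in>I. \<beta> i (w p) (c' i p v))" for p v
  have "\<exists>w'. (w has_derivative w') (at p) \<and> (\<forall>v. w' v = b1 p v + (\<Sum>i\<in>I. \<beta> i (w' v) (c i p)))"
    if p: "p \<in> S" for p
  proof -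
    have D: "((\<lambda>(q, x). b q + (\<Sum>i\<in>I. \<beta> i x (c i q))) has_derivative
        (\<lambda>(h, x). b1 p h + (\<Sum>i\<in>I. \<beta> i x (c i p)))) (at (p, w p))"
    proof -
      have f: "(fst has_derivative fst) (at (p, w p))" "(snd has_derivative snd) (at (p, w p))"
        by (auto intro: bounded_linear_imp_has_derivative bounded_linear_fst bounded_linear_snd)
      have b2: "((\<lambda>z. b (fst z)) has_derivative (\<lambda>z. b' p (fst z))) (at (p, w p))"
        using diff_chain_at[OF f(1), of b "b' p"] b'(1)[OF p] by (simp add: o_def)
      have c2: "((\<lambda>z. c i (fst z)) has_derivative (\<lambda>z. c' i p (fst z))) (at (p, w p))" if "i \<in> I" for i
        using diff_chain_at[OF f(1), of "c i" "c' i p"] c'[OF p that] by (simp add: o_def)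
      have "((\<lambda>z. b (fst z) + (\<Sum>i\<in>I. \<beta> i (snd z) (c i (fst z)))) has_derivative
         (\<lambda>z. b' p (fst z) + (\<Sum>i\<in>I. \<beta> i (snd (p, w p)) (c' i p (fst z)) + \<beta> i (snd z) (c i (fst (p, w p)))))) (at (p, w p))"
        by (intro has_derivative_add b2 has_derivative_sum bounded_bilinear.FDERIV[OF bil] f(2) c2)
      then show ?thesis by (simp add: case_prod_unfold b1_def sum.distrib add.assoc)
    qed
    have bl: "bounded_linear (b1 p)"
    proof -
      have "bounded_linear (b' p)" using b'(1)[OF p] has_derivative_bounded_linear by blast
      moreover have "bounded_linear (c' i p)" if "i \<in> I" for i
        using c'[OF p that] has_derivative_bounded_linear by blast
      ultimately show ?thesis unfolding b1_def
        by (intro bounded_linear_add bounded_linear_sum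
            bounded_linear_compose[OF bounded_bilinear.bounded_linear_right[OF bil]])
    qed
    have T: "bounded_linear (\<lambda>x. \<Sum>i\<in>I. \<beta> i x (c i p))"
      by (intro bounded_linear_sum bounded_bilinear.bounded_linear_left[OF bil])
    have cont: "isCont w p"
      using Ck_on_continuous_on[OF w0] S p by (simp add: continuous_on_eq_continuous_at)
    show ?thesis
      by (rule fixed_point_has_derivative[OF complete D bl T contr[OF p] S p Suc.prems(3) cont]) auto
  qed
  then have "\<forall>p. \<exists>w'. p \<in> S \<longrightarrow> (w has_derivative w') (at p) \<and>
      (\<forall>v. w' v = b1 p v + (\<Sum>i\<in>I. \<beta> i (w' v) (c i p)))" by blast
  from choice[OF this] obtain W where W: "\<forall>p. p \<in> S \<longrightarrow> (w has_derivative W p) (at p) \<and>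
      (\<forall>v. W p v = b1 p v + (\<Sum>i\<in>I. \<beta> i (W p v) (c i p)))" ..
  show ?case
  proof (rule Ck_on_SucI[OF S])
    show "(w has_derivative W p) (at p)" if "p \<in> S" for p using W that by blast
    show "Ck_on k S (\<lambda>p. W p v)" for v
    proof (rule Suc.IH)
      show "Ck_on k S (\<lambda>p. b1 p v)" unfolding b1_def
        by (intro Ck_on_add S b' Ck_on_sum Ck_on_bilinear[OF bil] w0 c'k)
    qed (use W c0 in auto)
  qed
qed

section \<open>Bounded sequences and superposition operators\<close>

lemma apply_Bcontfun_nat:
  fixes f :: "nat \<Rightarrow> 'a::real_normed_vector"
  assumes "\<And>k. norm (f k) \<le> c"
  shows "apply_bcontfun (Bcontfun f) = f"
  by (rule Bcontfun_inverse) (rule bcontfun_normI, use assms in auto)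

text \<open>
  Convergence in this space is uniform convergence, so only the values have to form a complete space.
\<close>
lemma complete_UNIV_bseq: "complete (UNIV :: (nat \<Rightarrow>\<^sub>C 'a::complete_space) set)"
  unfolding complete_def
proof (intro allI impI)
  fix f :: "nat \<Rightarrow> nat \<Rightarrow>\<^sub>C 'a"
  assume "(\<forall>n. f n \<in> UNIV) \<and> Cauchy f"
  then have "Cauchy f" by simp
  then obtain g where "uniform_limit UNIV f g sequentially"
    using uniformly_convergent_eq_cauchy[of "\<lambda>_. True" "\<lambda>n. apply_bcontfun (f n)"]
    unfolding Cauchy_def uniform_limit_sequentially_iff
    by (metis dist_fun_lt_imp_dist_val_lt)
  from uniform_limit_bcontfunE[OF this sequentially_bot]
  show "\<exists>l\<in>UNIV. f \<longlonglongrightarrow> l" by (metis UNIV_I)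
qed

lemma bounded_linear_bseqI:
  fixes T :: "'x::real_normed_vector \<Rightarrow> nat \<Rightarrow>\<^sub>C 'b::real_normed_vector"
  assumes "\<And>x k. apply_bcontfun (T x) k = t x k"
    and "\<And>x y k. t (x + y) k = t x k + t y k" "\<And>c x k. t (c *\<^sub>R x) k = c *\<^sub>R t x k"
    and "\<And>x k. norm (t x k) \<le> norm x * C"
  shows "bounded_linear T"
  by (rule bounded_linear_intro[where K = C])
    (auto intro!: bcontfun_eqI norm_bound simp: assms)

lemma bounded_linear_apply_bcontfun: "bounded_linear (\<lambda>c. apply_bcontfun c k)"
  by (rule bounded_linear_intro[where K = 1]) (auto simp: norm_bounded)

lemma bounded_linear_const_bcontfun:
  "bounded_linear (const_bcontfun :: 'a::real_normed_vector \<Rightarrow> nat \<Rightarrow>\<^sub>C 'a)"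
  by (rule bounded_linear_bseqI[where t = "\<lambda>x k. x" and C = 1]) auto

lemma apply_bcontfun_sum:
  "apply_bcontfun (\<Sum>i\<in>I. f i) k = (\<Sum>i\<in>I. apply_bcontfun (f i) k)"
  by (induction I rule: infinite_finite_induct) auto

definition shift :: "(nat \<Rightarrow>\<^sub>C 'a) \<Rightarrow> nat \<Rightarrow>\<^sub>C 'a::real_normed_vector" where
  "shift c = Bcontfun (\<lambda>k. c (Suc k))"

lemma shift_apply [simp]: "apply_bcontfun (shift c) k = c (Suc k)"
  unfolding shift_def by (subst apply_Bcontfun_nat[of _ "norm c"]) (auto simp: norm_bounded)

lemma bounded_linear_shift: "bounded_linear shift"
  by (rule bounded_linear_bseqI[where t = "\<lambda>c k. apply_bcontfun c (Suc k)" and C = 1]) (auto simp: norm_bounded)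

lemma norm_shift_le: "norm (shift c) \<le> norm c"
  by (rule norm_bound) (auto simp: norm_bounded)

text \<open>
  The superposition (Nemytskii) operator of \<open>\<phi>\<close> on bounded sequences. The image sequence is bounded
  when \<open>\<phi>\<close> is continuous, because the entries of \<open>y\<close> stay in a compact ball.
\<close>
definition superpose :: "('a \<Rightarrow> 'b) \<Rightarrow> (nat \<Rightarrow>\<^sub>C 'a::euclidean_space) \<Rightarrow> nat \<Rightarrow>\<^sub>C 'b::real_normed_vector" where
  "superpose \<phi> y = Bcontfun (\<lambda>k. \<phi> (y k))"

lemma superpose_apply:
  assumes "continuous_on UNIV \<phi>"
  shows "apply_bcontfun (superpose \<phi> y) k = \<phi> (y k)"
proof -
  have "compact (\<phi> ` cball 0 (norm y))"
    by (intro compact_continuous_image continuous_on_subset[OF assms]) auto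
  then obtain c where "\<And>x. x \<in> cball 0 (norm y) \<Longrightarrow> norm (\<phi> x) \<le> c"
    using compact_imp_bounded bounded_iff by (metis imageI)
  then show ?thesis
    unfolding superpose_def by (subst apply_Bcontfun_nat[of _ c]) (auto simp: norm_bounded)
qed

lemma bounded_linear_superpose:
  assumes "bounded_linear l"
  shows "bounded_linear (superpose l)"
proof -
  interpret l: bounded_linear l by fact
  obtain C where "0 < C" "\<And>x. norm (l x) \<le> norm x * C" using l.pos_bounded by blast
  then have "norm (l (y k)) \<le> norm y * C" for y :: "nat \<Rightarrow>\<^sub>C 'a" and k
    by (meson mult_right_mono norm_bounded order_trans less_imp_le)
  then show ?thesis
    by (intro bounded_linear_bseqI[where t = "\<lambda>y k. l (apply_bcontfun y k)" and C = C])
      (auto simp: superpose_apply linear_continuous_on assms l.add l.scaleR)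
qed

lemma uniform_continuity_on_balls:
  fixes \<phi> :: "'a::euclidean_space \<Rightarrow> 'b::real_normed_vector"
  assumes "continuous_on UNIV \<phi>" "e > 0"
  obtains d where "d > 0" "\<And>x y. norm x \<le> R \<Longrightarrow> norm (y - x) < d \<Longrightarrow> norm (\<phi> y - \<phi> x) \<le> e"
proof -
  have "uniformly_continuous_on (cball 0 (R + 1)) \<phi>"
    by (intro compact_uniformly_continuous continuous_on_subset[OF assms(1)]) auto
  then obtain d where d: "d > 0" "\<And>x y. x \<in> cball 0 (R + 1) \<Longrightarrow> y \<in> cball 0 (R + 1) \<Longrightarrow>
      norm (y - x) < d \<Longrightarrow> norm (\<phi> y - \<phi> x) < e"
    unfolding uniformly_continuous_on_def dist_norm using assms(2) by metis
  show ?thesis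
  proof (rule that[of "min d 1"])
    fix x y :: 'a assume *: "norm x \<le> R" "norm (y - x) < min d 1"
    then have "norm y \<le> R + 1" using norm_triangle_sub[of y x] by simp
    then show "norm (\<phi> y - \<phi> x) \<le> e" using d(2)[of x y] * by simp
  qed (use d in simp)
qed

lemma isCont_superpose:
  assumes "continuous_on UNIV \<phi>"
  shows "isCont (superpose \<phi>) y"
  unfolding continuous_at_eps_delta dist_norm
proof (intro allI impI)
  fix e :: real assume "e > 0"
  obtain d where d: "d > 0" "\<And>a b. norm a \<le> norm y \<Longrightarrow> norm (b - a) < d \<Longrightarrow> norm (\<phi> b - \<phi> a) \<le> e / 2"
    using uniform_continuity_on_balls[OF assms half_gt_zero[OF \<open>e > 0\<close>], of "norm y"] by metis
  have "norm (superpose \<phi> x - superpose \<phi> y) < e" if "norm (x - y) < d" for x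
  proof -
    have "norm (superpose \<phi> x - superpose \<phi> y) \<le> e / 2"
    proof (rule norm_bound)
      fix k
      have "norm (x k - y k) < d" using norm_bounded[of "x - y" k] that by simp
      then show "norm (apply_bcontfun (superpose \<phi> x - superpose \<phi> y) k) \<le> e / 2"
        using d(2)[OF norm_bounded[of y k]] by (simp add: superpose_apply[OF assms])
    qed
    then show ?thesis using \<open>e > 0\<close> by simp
  qed
  then show "\<exists>d>0. \<forall>x. norm (x - y) < d \<longrightarrow> norm (superpose \<phi> x - superpose \<phi> y) < e"
    using d(1) by blast
qed

lemma norm_linear_le_Basis:
  fixes l :: "'a::euclidean_space \<Rightarrow> 'b::real_normed_vector"
  assumes "linear l" "\<And>b. b \<in> Basis \<Longrightarrow> norm (l b) \<le> e"
  shows "norm (l h) \<le> norm h * (real DIM('a) * e)"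
proof -
  have "l h = l (\<Sum>b\<in>Basis. (h \<bullet> b) *\<^sub>R b)" by (simp add: euclidean_representation)
  also have "\<dots> = (\<Sum>b\<in>Basis. (h \<bullet> b) *\<^sub>R l b)"
    by (simp add: linear_sum[OF assms(1)] linear_scale[OF assms(1)])
  also have "norm \<dots> \<le> (\<Sum>b\<in>(Basis::'a set). norm h * e)"
    by (rule sum_norm_le) (auto intro!: mult_mono assms(2) Basis_le_norm)
  finally show ?thesis by (simp add: algebra_simps)
qed

text \<open>
  The remainder of a \<open>C\<^sup>1\<close> function is small uniformly on bounded sets: apply the mean value inequality
  to \<open>\<phi> - \<phi>' x\<close>, whose derivative near \<open>x\<close> is small by uniform continuity of the finitely many
  partial derivatives. This uniformity is what lifts differentiability to sequences.
\<close>
lemma uniform_derivative_on_balls: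
  fixes \<phi> :: "'a::euclidean_space \<Rightarrow> 'b::real_normed_vector"
  assumes der: "\<And>x. (\<phi> has_derivative \<phi>' x) (at x)"
    and cont: "\<And>v. continuous_on UNIV (\<lambda>x. \<phi>' x v)" and "e > 0"
  obtains d where "d > 0"
    "\<And>x h. norm x \<le> R \<Longrightarrow> norm h < d \<Longrightarrow> norm (\<phi> (x + h) - \<phi> x - \<phi>' x h) \<le> e * norm h"
proof -
  let ?e = "e / real DIM('a)"
  have e: "?e > 0" using \<open>e > 0\<close> by simp
  have "\<exists>d>0. \<forall>x y. norm x \<le> R \<longrightarrow> norm (y - x) < d \<longrightarrow> norm (\<phi>' y v - \<phi>' x v) \<le> ?e" for v
    by (rule uniform_continuity_on_balls[OF cont e, of R v]) blast
  then have "\<forall>v. \<exists>d. d > 0 \<and> (\<forall>x y. norm x \<le> R \<longrightarrow> norm (y - x) < d \<longrightarrow> norm (\<phi>' y v - \<phi>' x v) \<le> ?e)"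
    by blast
  from choice[OF this] obtain D where D: "\<forall>v. D v > 0 \<and>
      (\<forall>x y. norm x \<le> R \<longrightarrow> norm (y - x) < D v \<longrightarrow> norm (\<phi>' y v - \<phi>' x v) \<le> ?e)" ..
  define d where "d = Min (D ` (Basis :: 'a set))"
  have d: "d > 0" "\<And>b. b \<in> Basis \<Longrightarrow> d \<le> D b"
  proof -
    have "D b > 0" for b using D by blast
    then show "d > 0" by (auto simp: d_def)
    show "d \<le> D b" if "b \<in> Basis" for b using that by (auto simp: d_def)
  qed
  have lin: "linear (\<phi>' x)" for x by (rule has_derivative_linear[OF der])
  show ?thesis
  proof (rule that[OF d(1)])
    fix x h :: 'a assume x: "norm x \<le> R" and h: "norm h < d"
    have "norm ((\<lambda>y. \<phi> y - \<phi>' x y) (x + h) - (\<lambda>y. \<phi> y - \<phi>' x y) x) \<le> e * norm (x + h - x)"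
    proof (rule differentiable_bound[where S = "ball x d" and f' = "\<lambda>y k. \<phi>' y k - \<phi>' x k"])
      show "((\<lambda>y. \<phi> y - \<phi>' x y) has_derivative (\<lambda>k. \<phi>' y k - \<phi>' x k)) (at y within ball x d)" for y
        by (intro has_derivative_diff has_derivative_at_withinI[OF der]
            bounded_linear_imp_has_derivative lin[unfolded linear_conv_bounded_linear])
      fix y assume y: "y \<in> ball x d"
      have "norm (\<phi>' y k - \<phi>' x k) \<le> norm k * (real DIM('a) * ?e)" for k
      proof (rule norm_linear_le_Basis[OF linear_compose_sub[OF lin lin]])
        fix b :: 'a assume "b \<in> Basis"
        then have "norm (y - x) < D b"
          using y d(2)[of b] by (simp add: dist_norm norm_minus_commute)
        then show "norm (\<phi>' y b - \<phi>' x b) \<le> ?e" using D x by blast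
      qed
      then show "onorm (\<lambda>k. \<phi>' y k - \<phi>' x k) \<le> e"
        by (intro onorm_le) (simp add: mult.commute)
    qed (use h d(1) in \<open>auto simp: dist_norm\<close>)
    then show "norm (\<phi> (x + h) - \<phi> x - \<phi>' x h) \<le> e * norm h"
      by (simp add: linear_add[OF lin] algebra_simps)
  qed
qed

text \<open>
  The building block of the derivative of \<open>superpose \<phi>\<close>: expanding the increment \<open>w\<^sub>k\<close> in the basis
  turns \<open>\<phi>'(y\<^sub>k) w\<^sub>k\<close> into a finite sum of products of a coordinate of \<open>w\<close> with a sequence of
  partial derivatives, each bilinear in the two sequences.
\<close>
definition basis_mult ::
  "'a::euclidean_space \<Rightarrow> (nat \<Rightarrow>\<^sub>C 'a) \<Rightarrow> (nat \<Rightarrow>\<^sub>C 'b) \<Rightarrow> nat \<Rightarrow>\<^sub>C 'b::real_normed_vector" where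
  "basis_mult b w c = Bcontfun (\<lambda>k. (w k \<bullet> b) *\<^sub>R c k)"

lemma norm_basis_mult_le:
  fixes w :: "nat \<Rightarrow>\<^sub>C 'a::euclidean_space" and c :: "nat \<Rightarrow>\<^sub>C 'b::real_normed_vector"
  shows "norm ((w k \<bullet> b) *\<^sub>R c k) \<le> norm w * norm c * norm b"
proof -
  have "\<bar>w k \<bullet> b\<bar> \<le> norm w * norm b"
    by (meson Cauchy_Schwarz_ineq2 mult_right_mono norm_bounded norm_ge_zero order_trans)
  then have "\<bar>w k \<bullet> b\<bar> * norm (c k) \<le> (norm w * norm b) * norm c"
    by (intro mult_mono) (auto simp: norm_bounded)
  then show ?thesis by (simp add: mult_ac)
qed

lemma basis_mult_apply [simp]: "apply_bcontfun (basis_mult b w c) k = (w k \<bullet> b) *\<^sub>R c k"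
  unfolding basis_mult_def by (subst apply_Bcontfun_nat[OF norm_basis_mult_le]) simp

lemma bounded_bilinear_basis_mult: "bounded_bilinear (basis_mult b)"
proof
  show "\<exists>K. \<forall>w c. norm (basis_mult b w c) \<le> norm w * norm c * K"
    by (intro exI[of _ "norm b"] allI norm_bound) (simp add: norm_basis_mult_le del: norm_scaleR)
qed (auto intro!: bcontfun_eqI simp: algebra_simps inner_add_left)

text \<open>
  The remainder is estimated entry by entry. The entries of \<open>y\<close> lie in a common ball, so the estimates
  of \<open>uniform_derivative_on_balls\<close> hold with one radius for all of them. The second part says that the
  derivative acts on each entry as \<open>\<phi>'\<close> does.
\<close>
lemma superpose_has_derivative:
  fixes \<phi> :: "'a::euclidean_space \<Rightarrow> 'b::real_normed_vector"
  assumes der: "\<And>x. (\<phi> has_derivative \<phi>' x) (at x)"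
    and cont: "\<And>v. continuous_on UNIV (\<lambda>x. \<phi>' x v)"
  shows "(superpose \<phi> has_derivative (\<lambda>w. \<Sum>b\<in>Basis. basis_mult b w (superpose (\<lambda>x. \<phi>' x b) y))) (at y)"
    and "apply_bcontfun (\<Sum>b\<in>Basis. basis_mult b w (superpose (\<lambda>x. \<phi>' x b) y)) k = \<phi>' (y k) (w k)"
proof -
  have lin: "linear (\<phi>' x)" for x by (rule has_derivative_linear[OF der])
  have ap: "apply_bcontfun (\<Sum>b\<in>Basis. basis_mult b w (superpose (\<lambda>x. \<phi>' x b) y)) k = \<phi>' (y k) (w k)"
    for w k
  proof -
    have "\<phi>' (y k) (w k) = \<phi>' (y k) (\<Sum>b\<in>Basis. (w k \<bullet> b) *\<^sub>R b)"
      by (simp add: euclidean_representation)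
    also have "\<dots> = (\<Sum>b\<in>Basis. (w k \<bullet> b) *\<^sub>R \<phi>' (y k) b)"
      by (simp add: linear_sum[OF lin] linear_scale[OF lin])
    finally show ?thesis by (simp add: apply_bcontfun_sum superpose_apply cont)
  qed
  then show "apply_bcontfun (\<Sum>b\<in>Basis. basis_mult b w (superpose (\<lambda>x. \<phi>' x b) y)) k = \<phi>' (y k) (w k)" .
  have \<phi>: "continuous_on UNIV \<phi>"
    using has_derivative_continuous[OF der] by (simp add: continuous_on_eq_continuous_within)
  have bl: "bounded_linear (\<lambda>w. \<Sum>b\<in>Basis. basis_mult b w (superpose (\<lambda>x. \<phi>' x b) y))"
    by (intro bounded_linear_sum bounded_bilinear.bounded_linear_left[OF bounded_bilinear_basis_mult])
  show "(superpose \<phi> has_derivative (\<lambda>w. \<Sum>b\<in>Basis. basis_mult b w (superpose (\<lambda>x. \<phi>' x b) y))) (at y)"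
    unfolding has_derivative_at_alt
  proof (intro conjI bl allI impI)
    fix e :: real assume "e > 0"
    obtain d where d: "d > 0" "\<And>x h. norm x \<le> norm y \<Longrightarrow> norm h < d \<Longrightarrow>
        norm (\<phi> (x + h) - \<phi> x - \<phi>' x h) \<le> e * norm h"
      using uniform_derivative_on_balls[OF der cont \<open>e > 0\<close>] by metis
    have "norm (superpose \<phi> z - superpose \<phi> y
        - (\<Sum>b\<in>Basis. basis_mult b (z - y) (superpose (\<lambda>x. \<phi>' x b) y))) \<le> e * norm (z - y)"
      if "norm (z - y) < d" for z
    proof (rule norm_bound)
      fix k
      have "norm ((z - y) k) < d" using norm_bounded[of "z - y" k] that by simp
      from d(2)[OF norm_bounded[of y k] this]
      have "norm (\<phi> (z k) - \<phi> (y k) - \<phi>' (y k) (z k - y k)) \<le> e * norm ((z - y) k)" by simp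
      also have "\<dots> \<le> e * norm (z - y)"
        using \<open>e > 0\<close> by (intro mult_left_mono norm_bounded) auto
      finally show "norm (apply_bcontfun (superpose \<phi> z - superpose \<phi> y
        - (\<Sum>b\<in>Basis. basis_mult b (z - y) (superpose (\<lambda>x. \<phi>' x b) y))) k) \<le> e * norm (z - y)"
        by (simp add: ap superpose_apply[OF \<phi>])
    qed
    then show "\<exists>d>0. \<forall>z. norm (z - y) < d \<longrightarrow> norm (superpose \<phi> z - superpose \<phi> y
        - (\<Sum>b\<in>Basis. basis_mult b (z - y) (superpose (\<lambda>x. \<phi>' x b) y))) \<le> e * norm (z - y)"
      using d(1) by blast
  qed
qed

text \<open>
  Induction on \<open>r\<close>: by the chain rule a directional derivative of \<open>superpose \<phi> \<circ> u\<close> is a sum of bilinear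
  expressions in a derivative of \<open>u\<close> and superpositions of partial derivatives of \<open>\<phi>\<close>.
\<close>
lemma Ck_on_superpose:
  assumes "open S" "Ck_on r UNIV \<phi>" "Ck_on r S u"
  shows "Ck_on r S (\<lambda>p. superpose \<phi> (u p))"
  using assms(2,3)
proof (induction r arbitrary: \<phi>)
  case 0
  then show ?case
    using continuous_on_compose2[of UNIV "superpose \<phi>" S u]
    by (simp add: continuous_at_imp_continuous_on isCont_superpose)
next
  case (Suc r)
  obtain \<phi>' where \<phi>': "\<And>x. (\<phi> has_derivative \<phi>' x) (at x)" "\<And>v. Ck_on r UNIV (\<lambda>x. \<phi>' x v)"
    using Ck_on_UNIV_SucE[OF Suc.prems(1)] by blast
  obtain u' where u': "\<And>x. x \<in> S \<Longrightarrow> (u has_derivative u' x) (at x)"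
    "\<And>v. Ck_on r S (\<lambda>x. u' x v)" using Ck_on_SucE[OF Suc.prems(2)] by blast
  show ?case
  proof (rule Ck_on_SucI[where f' = "\<lambda>p v. \<Sum>b\<in>Basis. basis_mult b (u' p v) (superpose (\<lambda>x. \<phi>' x b) (u p))"])
    show "((\<lambda>p. superpose \<phi> (u p)) has_derivative
        (\<lambda>v. \<Sum>b\<in>Basis. basis_mult b (u' p v) (superpose (\<lambda>x. \<phi>' x b) (u p)))) (at p)" if "p \<in> S" for p
      using diff_chain_at[OF u'(1)[OF that] superpose_has_derivative(1)[OF \<phi>'(1) Ck_on_continuous_on[OF \<phi>'(2)]]]
      by (simp add: o_def)
    show "Ck_on r S (\<lambda>p. \<Sum>b\<in>Basis. basis_mult b (u' p v) (superpose (\<lambda>x. \<phi>' x b) (u p)))" for v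
      by (intro Ck_on_sum Ck_on_bilinear[OF bounded_bilinear_basis_mult] assms(1) u' Suc.IH \<phi>'
          Ck_on_Suc_imp[OF Suc.prems(2)])
  qed (fact assms)
qed

text \<open>
  The ordinary composition is read off from the superposition operator on constant sequences.
\<close>
lemma Ck_on_compose:
  fixes \<phi> :: "'a::euclidean_space \<Rightarrow> 'b::real_normed_vector"
  assumes "open S" "Ck_on r UNIV \<phi>" "Ck_on r S u"
  shows "Ck_on r S (\<lambda>p. \<phi> (u p))"
proof -
  have "Ck_on r S (\<lambda>p. apply_bcontfun (superpose \<phi> (const_bcontfun (u p))) 0)"
    by (intro Ck_on_linear_compose[OF bounded_linear_apply_bcontfun] Ck_on_superpose assms
        Ck_on_linear_compose[OF bounded_linear_const_bcontfun])
  then show ?thesis by (simp add: superpose_apply[OF Ck_on_continuous_on[OF assms(2)]])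
qed

section \<open>The solution map of a nonlinear equation for sequences\<close>

lemma bounded_bilinear_post_compose:
  assumes "bounded_linear f" "bounded_bilinear \<beta>"
  shows "bounded_bilinear (\<lambda>x y. f (\<beta> x y))"
proof -
  interpret f: bounded_linear f by fact
  interpret bounded_bilinear \<beta> by fact
  obtain C where C: "C \<ge> 0" "\<And>x. norm (f x) \<le> norm x * C" using f.nonneg_bounded by blast
  from bounded obtain K where K: "\<forall>x y. norm (\<beta> x y) \<le> norm x * norm y * K" ..
  have "norm (f (\<beta> x y)) \<le> norm x * norm y * (K * C)" for x y
    using C(2)[of "\<beta> x y"] mult_right_mono[OF K[rule_format] C(1), of x y] by (simp add: mult_ac)
  then have "\<exists>K. \<forall>x y. norm (f (\<beta> x y)) \<le> norm x * norm y * K" by blast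
  then show ?thesis
    by unfold_locales (simp_all add: add_left add_right scaleR_left scaleR_right f.add f.scaleR)
qed

lemma small_derivative_near_zero:
  fixes \<phi>' :: "'a::euclidean_space \<Rightarrow> 'a \<Rightarrow> 'b::real_normed_vector"
  assumes lin: "\<And>x. linear (\<phi>' x)" and cont: "\<And>v. isCont (\<lambda>x. \<phi>' x v) 0"
    and zero: "\<And>v. \<phi>' 0 v = 0" and "e > 0"
  obtains d where "d > 0" "\<And>x h. norm x \<le> d \<Longrightarrow> norm (\<phi>' x h) \<le> e * norm h"
proof -
  let ?e = "e / real DIM('a)"
  have "?e > 0" using \<open>e > 0\<close> by simp
  then have "\<forall>\<^sub>F x in nhds 0. norm (\<phi>' x b) < ?e" for b
    using cont[of b] tendstoD[of "\<lambda>x. \<phi>' x b" 0 "at 0" ?e]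
    by (simp add: isCont_def zero eventually_nhds_conv_at)
  then have "\<forall>\<^sub>F x in nhds 0. \<forall>b\<in>Basis. norm (\<phi>' x b) < ?e"
    by (simp add: eventually_ball_finite)
  then obtain d where d: "d > 0" "\<And>x b. norm x < d \<Longrightarrow> b \<in> Basis \<Longrightarrow> norm (\<phi>' x b) < ?e"
    unfolding eventually_nhds_metric by auto
  show ?thesis
  proof (rule that[of "d/2"])
    fix x h :: 'a assume x: "norm x \<le> d / 2"
    have "norm (\<phi>' x h) \<le> norm h * (real DIM('a) * ?e)"
      by (rule norm_linear_le_Basis[OF lin]) (use d x in \<open>auto intro!: less_imp_le\<close>)
    then show "norm (\<phi>' x h) \<le> e * norm h" by (simp add: mult.commute)
  qed (use d in simp)
qed

text \<open>
  The equation \<open>y = Lo p + Go (superpose \<phi> y)\<close> is solved by the contraction principle in a ball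
  of radius \<open>\<delta>\<close>, chosen so small that \<open>\<phi>'\<close> there is below \<open>1 / (2 \<parallel>Go\<parallel>)\<close>. The derivative of the solution
  in direction \<open>v\<close> satisfies \<open>w = Lo v + Go (\<phi>'(u) w)\<close>, so it is as
  smooth as \<open>u\<close> and \<open>\<phi>'\<close> are, which yields the smoothness of \<open>u\<close> order by order. The free
  bound \<open>\<eta>\<close> on the nonlinearity serves the later proof that trajectories decay.
\<close>
lemma solution_map:
  fixes Lo :: "'p::euclidean_space \<Rightarrow> nat \<Rightarrow>\<^sub>C 'a::euclidean_space"
    and Go :: "(nat \<Rightarrow>\<^sub>C 'b::{real_normed_vector}) \<Rightarrow> nat \<Rightarrow>\<^sub>C 'a"
    and \<phi> :: "'a \<Rightarrow> 'b"
  assumes Lo: "bounded_linear Lo" and CL: "CL \<ge> 0" "\<And>p. norm (Lo p) \<le> CL * norm p"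
    and Go: "bounded_linear Go"
    and \<phi>: "Ck_on r UNIV \<phi>" "r \<ge> 1" "\<phi> 0 = 0" "(\<phi> has_derivative (\<lambda>_. 0)) (at 0)"
    and "\<eta> > 0"
  obtains \<delta> \<rho> u where "\<delta> > 0" "\<rho> > 0"
    "\<And>p. p \<in> ball 0 \<rho> \<Longrightarrow> norm (u p) \<le> \<delta>"
    "\<And>p. p \<in> ball 0 \<rho> \<Longrightarrow> u p = Lo p + Go (superpose \<phi> (u p))"
    "\<And>p y. p \<in> ball 0 \<rho> \<Longrightarrow> norm y \<le> \<delta> \<Longrightarrow> y = Lo p + Go (superpose \<phi> y) \<Longrightarrow> y = u p"
    "\<And>p. p \<in> ball 0 \<rho> \<Longrightarrow> norm (u p) \<le> 2 * CL * norm p"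
    "\<And>y. norm y \<le> \<delta> \<Longrightarrow> norm (superpose \<phi> y) \<le> \<eta> * norm y"
    "Ck_on r (ball 0 \<rho>) u"
proof -
  obtain r' where r': "r = Suc r'" using \<phi>(2) by (cases r) auto
  obtain \<phi>' where \<phi>': "\<And>x. (\<phi> has_derivative \<phi>' x) (at x)" "\<And>v. Ck_on r' UNIV (\<lambda>x. \<phi>' x v)"
    using Ck_on_UNIV_SucE[OF \<phi>(1)[unfolded r']] by blast
  have \<phi>'c: "continuous_on UNIV (\<lambda>x. \<phi>' x v)" for v by (rule Ck_on_continuous_on[OF \<phi>'(2)])
  have \<phi>'0: "\<phi>' 0 v = 0" for v using has_derivative_unique[OF \<phi>'(1) \<phi>(4)] by metis
  have \<phi>c: "continuous_on UNIV \<phi>" by (rule Ck_on_continuous_on[OF \<phi>(1)])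
  interpret Lo: bounded_linear Lo by fact
  interpret Go: bounded_linear Go by fact
  obtain CG where CG: "CG > 0" "\<And>w. norm (Go w) \<le> norm w * CG" using Go.pos_bounded by blast
  define e where "e = min \<eta> (1 / (2 * CG))"
  have e: "e > 0" "e \<le> \<eta>" "e * CG \<le> 1 / 2"
    using \<open>\<eta> > 0\<close> CG(1) mult_right_mono[of e "1 / (2 * CG)" CG] by (auto simp: e_def)
  obtain \<delta> where \<delta>: "\<delta> > 0" "\<And>x h. norm x \<le> \<delta> \<Longrightarrow> norm (\<phi>' x h) \<le> e * norm h"
    by (rule small_derivative_near_zero[of \<phi>' e])
      (use \<phi>'c e(1) \<phi>'0 has_derivative_linear[OF \<phi>'(1)] in \<open>auto simp: continuous_on_eq_continuous_at\<close>)
  have lip: "norm (\<phi> x - \<phi> y) \<le> e * norm (x - y)" if "norm x \<le> \<delta>" "norm y \<le> \<delta>" for x y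
    by (rule differentiable_bound[where S = "cball 0 \<delta>" and f' = \<phi>'])
      (use that \<delta> in \<open>auto intro!: onorm_le has_derivative_at_withinI \<phi>'\<close>)
  have Lip: "norm (superpose \<phi> x - superpose \<phi> y) \<le> e * norm (x - y)"
    if "norm x \<le> \<delta>" "norm y \<le> \<delta>" for x y
  proof (rule norm_bound)
    fix k
    have "norm (\<phi> (x k) - \<phi> (y k)) \<le> e * norm ((x - y) k)"
      using lip[of "x k" "y k"] that norm_bounded[of x k] norm_bounded[of y k] by simp
    also have "\<dots> \<le> e * norm (x - y)" using e(1) by (intro mult_left_mono norm_bounded) simp
    finally show "norm (apply_bcontfun (superpose \<phi> x - superpose \<phi> y) k) \<le> e * norm (x - y)"
      by (simp add: superpose_apply[OF \<phi>c])
  qed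
  have sup0: "superpose \<phi> 0 = 0" by (rule bcontfun_eqI) (simp add: superpose_apply[OF \<phi>c] \<phi>(3))
  have GLip: "norm (Go (superpose \<phi> x) - Go (superpose \<phi> y)) \<le> norm (x - y) / 2"
    if "norm x \<le> \<delta>" "norm y \<le> \<delta>" for x y
  proof -
    have "norm (Go (superpose \<phi> x) - Go (superpose \<phi> y)) \<le> (e * norm (x - y)) * CG"
      unfolding Go.diff[symmetric] using CG Lip[OF that] by (meson mult_right_mono order_trans less_imp_le)
    also have "\<dots> = (e * CG) * norm (x - y)" by simp
    also have "\<dots> \<le> (1 / 2) * norm (x - y)" by (rule mult_right_mono[OF e(3)]) simp
    finally show ?thesis by simp
  qed
  \<comment> \<open>With this radius \<open>Lo p\<close> uses up at most half of \<open>\<delta>\<close>; the nonlinear part needs the other half.\<close>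
  define \<rho> where "\<rho> = \<delta> / (2 * (CL + 1))"
  have \<rho>: "\<rho> > 0" using \<delta>(1) CL(1) by (simp add: \<rho>_def)
  have Lo\<rho>: "norm (Lo p) \<le> \<delta> / 2" if "p \<in> ball 0 \<rho>" for p
  proof -
    have "norm (Lo p) \<le> CL * norm p" by (rule CL(2))
    also have "\<dots> \<le> (CL + 1) * \<rho>" using that CL(1) by (intro mult_mono) auto
    also have "\<dots> = \<delta> / 2" using CL(1) by (simp add: \<rho>_def field_simps)
    finally show ?thesis .
  qed
  have ex: "\<exists>!y\<in>cball 0 \<delta>. Lo p + Go (superpose \<phi> y) = y" if p: "p \<in> ball 0 \<rho>" for p
  proof (rule Banach_fix[of _ "1/2"])
    show "complete (cball (0 :: nat \<Rightarrow>\<^sub>C 'a) \<delta>)"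
      using complete_closed_subset[OF closed_cball subset_UNIV complete_UNIV_bseq] .
    show "(\<lambda>y. Lo p + Go (superpose \<phi> y)) ` cball 0 \<delta> \<subseteq> cball 0 \<delta>"
    proof safe
      fix y :: "nat \<Rightarrow>\<^sub>C 'a" assume "y \<in> cball 0 \<delta>"
      then have "norm (Go (superpose \<phi> y)) \<le> \<delta> / 2" "norm y \<le> \<delta>"
        using GLip[of y 0] \<delta>(1) by (auto simp: sup0 Go.zero)
      then show "Lo p + Go (superpose \<phi> y) \<in> cball 0 \<delta>"
        using norm_triangle_ineq[of "Lo p" "Go (superpose \<phi> y)"] Lo\<rho>[OF p] by simp
    qed
  qed (use \<delta> GLip in \<open>auto simp: dist_norm\<close>)
  define u where "u p = (THE y. y \<in> cball 0 \<delta> \<and> Lo p + Go (superpose \<phi> y) = y)" for p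
  have u: "u p \<in> cball 0 \<delta> \<and> Lo p + Go (superpose \<phi> (u p)) = u p" if "p \<in> ball 0 \<rho>" for p
    unfolding u_def by (rule theI'[OF ex[OF that]])
  have u_bound: "norm (u p) \<le> \<delta>" and u_eq: "u p = Lo p + Go (superpose \<phi> (u p))"
    if "p \<in> ball 0 \<rho>" for p using u[OF that] by auto
  have u_unique: "y = u p" if "p \<in> ball 0 \<rho>" "norm y \<le> \<delta>" "y = Lo p + Go (superpose \<phi> y)" for p y
    using ex[OF that(1)] u[OF that(1)] that(2,3) by (metis mem_cball_0)
  have u_lip: "norm (u p - u q) \<le> 2 * CL * norm (p - q)" if "p \<in> ball 0 \<rho>" "q \<in> ball 0 \<rho>" for p q
  proof -
    have "u p - u q = (Lo p + Go (superpose \<phi> (u p))) - (Lo q + Go (superpose \<phi> (u q)))"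
      by (rule arg_cong2[of _ _ _ _ minus]) (rule u_eq, fact)+
    also have "\<dots> = Lo (p - q) + (Go (superpose \<phi> (u p)) - Go (superpose \<phi> (u q)))"
      by (simp add: Lo.diff)
    finally have "u p - u q = Lo (p - q) + (Go (superpose \<phi> (u p)) - Go (superpose \<phi> (u q)))" .
    then have "norm (u p - u q) \<le> CL * norm (p - q) + norm (u p - u q) / 2"
      by (metis norm_triangle_mono CL(2) GLip u_bound that)
    then show ?thesis by simp
  qed
  have u0: "u 0 = 0"
    using u_unique[of 0 0] \<rho> \<delta>(1) by (simp add: sup0 Go.zero Lo.zero)
  define D where "D y w = (\<Sum>b\<in>Basis. basis_mult b w (superpose (\<lambda>x. \<phi>' x b) y))" for y w
  have D: "(superpose \<phi> has_derivative D y) (at y)" "apply_bcontfun (D y w) k = \<phi>' (y k) (w k)" for y w k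
    unfolding D_def by (rule superpose_has_derivative[OF \<phi>'(1) \<phi>'c])+
  have D_small: "norm (D y w) \<le> e * norm w" if "norm y \<le> \<delta>" for y w
  proof (rule norm_bound)
    fix k
    have "norm (\<phi>' (y k) (w k)) \<le> e * norm (w k)"
      using \<delta>(2) norm_bounded[of y k] that by (meson order_trans)
    also have "\<dots> \<le> e * norm w" using e(1) by (intro mult_left_mono norm_bounded) simp
    finally show "norm (apply_bcontfun (D y w) k) \<le> e * norm w" by (simp add: D)
  qed
  have GD: "norm (Go (D y w)) \<le> norm w / 2" if "norm y \<le> \<delta>" for y w
  proof -
    have "norm (Go (D y w)) \<le> (e * norm w) * CG"
      using CG D_small[OF that] by (meson mult_right_mono order_trans less_imp_le)
    also have "\<dots> = (e * CG) * norm w" by simp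
    also have "\<dots> \<le> (1 / 2) * norm w" by (rule mult_right_mono[OF e(3)]) simp
    finally show ?thesis by simp
  qed
  have u_cont: "isCont u p" if p: "p \<in> ball 0 \<rho>" for p
  proof -
    have "((\<lambda>q. (2 * CL) * norm (q - p)) \<longlongrightarrow> 0) (at p)"
      by (intro tendsto_mult_right_zero tendsto_norm_zero LIM_zero) simp
    then have "((\<lambda>q. u q - u p) \<longlongrightarrow> 0) (at p)"
      by (rule Lim_null_comparison[rotated])
        (use u_lip[OF _ p] p in \<open>auto simp: eventually_at_topological intro!: exI[of _ "ball 0 \<rho>"]\<close>)
    then show ?thesis by (simp add: isCont_def LIM_zero_iff)
  qed
  have "\<exists>u'. (u has_derivative u') (at p) \<and> (\<forall>v. u' v = Lo v + Go (D (u p) (u' v)))"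
    if p: "p \<in> ball 0 \<rho>" for p
  proof -
    have "((\<lambda>(q, y). Lo q + Go (superpose \<phi> y)) has_derivative (\<lambda>(h, w). Lo h + Go (D (u p) w)))
        (at (p, u p))"
    proof -
      have f: "(fst has_derivative fst) (at (p, u p))" "(snd has_derivative snd) (at (p, u p))"
        by (auto intro: bounded_linear_imp_has_derivative bounded_linear_fst bounded_linear_snd)
      have "((\<lambda>z. superpose \<phi> (snd z)) has_derivative (\<lambda>z. D (u p) (snd z))) (at (p, u p))"
        using diff_chain_at[OF f(2), of "superpose \<phi>" "D (u p)"] D(1) by (simp add: o_def)
      then show ?thesis unfolding case_prod_unfold
        by (intro has_derivative_add Lo.has_derivative Go.has_derivative f(1))
    qed
    then show ?thesis
      by (rule fixed_point_has_derivative[where u = u and p = p and S = "ball 0 \<rho>" and b = Lo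
            and T = "\<lambda>w. Go (D (u p) w)" and \<Gamma> = "\<lambda>q y. Lo q + Go (superpose \<phi> y)",
            OF complete_UNIV_bseq _ Lo _ _ open_ball p u_eq u_cont[OF p]])
        (use has_derivative_bounded_linear[OF D(1)] GD[OF u_bound[OF p]] in
          \<open>auto intro!: bounded_linear_compose[OF Go]\<close>)
  qed
  then have "\<forall>p. \<exists>u'. p \<in> ball 0 \<rho> \<longrightarrow> (u has_derivative u') (at p) \<and>
      (\<forall>v. u' v = Lo v + Go (D (u p) (u' v)))" by blast
  from choice[OF this] obtain u' where u': "\<forall>p. p \<in> ball 0 \<rho> \<longrightarrow> (u has_derivative u' p) (at p) \<and>
      (\<forall>v. u' p v = Lo v + Go (D (u p) (u' p v)))" ..
  have Ck_mono: "Ck_on k UNIV \<psi>" if "Ck_on r' UNIV \<psi>" "k \<le> r'" for k and \<psi> :: "'a \<Rightarrow> 'b"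
    using that(2,1) by (induction rule: inc_induct) (auto dest: Ck_on_Suc_imp simp del: Ck_on.simps)
  \<comment> \<open>Bootstrapping: if \<open>u\<close> is \<open>C\<^sup>k\<close>, so are the coefficients of the equation for its derivative.\<close>
  have "k \<le> r \<Longrightarrow> Ck_on k (ball 0 \<rho>) u" for k
  proof (induction k)
    case 0
    then show ?case by (auto intro!: continuous_at_imp_continuous_on u_cont)
  next
    case (Suc k)
    then have uk: "Ck_on k (ball 0 \<rho>) u" and kr: "k \<le> r'" by (simp_all add: r')
    show ?case
    proof (rule Ck_on_SucI[OF open_ball])
      show "(u has_derivative u' p) (at p)" if "p \<in> ball 0 \<rho>" for p using u' that by blast
      fix v
      have Go_D: "(\<Sum>b\<in>Basis. Go (basis_mult b w (superpose (\<lambda>x. \<phi>' x b) (u p)))) = Go (D (u p) w)" for p w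
        by (simp add: D_def Go.sum)
      show "Ck_on k (ball 0 \<rho>) (\<lambda>p. u' p v)"
      proof (rule linear_fixed_point_Ck[where \<beta> = "\<lambda>b w c. Go (basis_mult b w c)" and I = Basis
              and b = "\<lambda>_. Lo v" and c = "\<lambda>b p. superpose (\<lambda>x. \<phi>' x b) (u p)"])
        show "bounded_bilinear (\<lambda>w c. Go (basis_mult b w c))" for b
          by (rule bounded_bilinear_post_compose[OF Go bounded_bilinear_basis_mult])
        show "Ck_on k (ball 0 \<rho>) (\<lambda>p. superpose (\<lambda>x. \<phi>' x b) (u p))" for b
          by (rule Ck_on_superpose[OF open_ball Ck_mono[OF \<phi>'(2) kr] uk])
        show "norm (\<Sum>b\<in>Basis. Go (basis_mult b w (superpose (\<lambda>x. \<phi>' x b) (u p)))) \<le> norm w / 2"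
          if "p \<in> ball 0 \<rho>" for p w unfolding Go_D by (rule GD[OF u_bound[OF that]])
        show "u' p v = Lo v + (\<Sum>b\<in>Basis. Go (basis_mult b (u' p v) (superpose (\<lambda>x. \<phi>' x b) (u p))))"
          if "p \<in> ball 0 \<rho>" for p unfolding Go_D using u' that by blast
      qed (rule complete_UNIV_bseq open_ball Ck_on_const)+
    qed
  qed
  then have u_Ck: "Ck_on r (ball 0 \<rho>) u" by simp
  have small: "norm (superpose \<phi> y) \<le> \<eta> * norm y" if "norm y \<le> \<delta>" for y
  proof -
    have "norm (superpose \<phi> y) \<le> e * norm y" using Lip[OF that, of 0] \<delta>(1) by (simp add: sup0)
    also have "\<dots> \<le> \<eta> * norm y" using e(2) by (rule mult_right_mono) simp
    finally show ?thesis .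
  qed
  have u_le: "norm (u p) \<le> 2 * CL * norm p" if "p \<in> ball 0 \<rho>" for p
    using u_lip[OF that, of 0] \<rho> by (simp add: u0)
  show ?thesis by (rule that[OF \<delta>(1) \<rho> u_bound u_eq u_unique u_le small u_Ck])
qed

section \<open>Linear recursions with stable powers\<close>

lemma linear_funpow: "linear (f :: 'a::real_vector \<Rightarrow> 'a) \<Longrightarrow> linear (f ^^ k)"
  by (induction k) (auto intro: linear_compose[unfolded o_def] simp: o_def id_def linear_iff)

text \<open>
  Stability in the form in which it is used: a summable majorant of the operator norms of the powers
  makes the sums over the past and over the future below converge.
\<close>
definition summable_powers :: "('a::real_normed_vector \<Rightarrow> 'a) \<Rightarrow> bool" where
  "summable_powers l \<longleftrightarrow> linear l \<and> (\<exists>a. summable a \<and> (\<forall>k x. norm ((l ^^ k) x) \<le> a k * norm x))"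

lemma summable_powersE:
  assumes "summable_powers (l :: 'a::real_normed_vector \<Rightarrow> 'a)"
  obtains a where "linear l" "summable a" "\<And>k. a k \<ge> 0" "\<And>k x. norm ((l ^^ k) x) \<le> a k * norm x"
proof -
  obtain a where a: "linear l" "summable a" "\<And>k x. norm ((l ^^ k) x) \<le> a k * norm x"
    using assms unfolding summable_powers_def by blast
  show ?thesis
  proof (cases "\<exists>x::'a. x \<noteq> 0")
    case True
    then obtain x :: 'a where "x \<noteq> 0" by blast
    then have "a k \<ge> 0" for k
      using order_trans[OF norm_ge_zero a(3)[of k x]] by (simp add: zero_le_mult_iff)
    with a that show ?thesis by blast
  next
    case False
    show ?thesis by (rule that[of "\<lambda>_. 0"]) (use a False in auto)
  qed
qed

text \<open>
  Variation of constants: the solution of \<open>x\<^bsub>k+1\<^esub> = l x\<^sub>k + c\<^sub>k\<close> with \<open>x\<^sub>0 = 0\<close>.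
\<close>
definition forward_sum :: "('a \<Rightarrow> 'a) \<Rightarrow> (nat \<Rightarrow>\<^sub>C 'a) \<Rightarrow> nat \<Rightarrow>\<^sub>C 'a::real_normed_vector" where
  "forward_sum l c = Bcontfun (\<lambda>k. \<Sum>j<k. (l ^^ (k - Suc j)) (c j))"

text \<open>
  The only bounded solution of \<open>z\<^sub>k = c\<^sub>k + l z\<^bsub>k+1\<^esub>\<close>: iterating the equation into the future, the
  remainder \<open>l\<^sup>j z\<^bsub>k+j\<^esub>\<close> vanishes.
\<close>
definition backward_sum :: "('a \<Rightarrow> 'a) \<Rightarrow> (nat \<Rightarrow>\<^sub>C 'a) \<Rightarrow> nat \<Rightarrow>\<^sub>C 'a::real_normed_vector" where
  "backward_sum l c = Bcontfun (\<lambda>k. \<Sum>j. (l ^^ j) (c (k + j)))"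

definition free_orbit :: "('a \<Rightarrow> 'a) \<Rightarrow> 'a \<Rightarrow> nat \<Rightarrow>\<^sub>C 'a::real_normed_vector" where
  "free_orbit l p = Bcontfun (\<lambda>k. (l ^^ k) p)"

context
  fixes l :: "'a::banach \<Rightarrow> 'a"
  assumes l: "summable_powers l"
begin

lemma forward_sum_bound:
  obtains C where "\<And>c k. norm (\<Sum>j<k. (l ^^ (k - Suc j)) (apply_bcontfun c j)) \<le> norm c * C"
proof -
  obtain a where a: "linear l" "summable a" "\<And>k. a k \<ge> 0" "\<And>k x. norm ((l ^^ k) x) \<le> a k * norm x"
    using summable_powersE[OF l] by blast
  have "norm (\<Sum>j<k. (l ^^ (k - Suc j)) (apply_bcontfun c j)) \<le> norm c * suminf a" for c k
  proof -
    have "norm (\<Sum>j<k. (l ^^ (k - Suc j)) (apply_bcontfun c j)) \<le> (\<Sum>j<k. a (k - Suc j) * norm c)"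
      by (rule sum_norm_le) (meson a(3,4) norm_bounded mult_left_mono order_trans)
    also have "\<dots> = (\<Sum>j<k. a j) * norm c"
      by (simp add: sum.nat_diff_reindex[of a k] flip: sum_distrib_right)
    also have "\<dots> \<le> suminf a * norm c"
      by (intro mult_right_mono sum_le_suminf a) auto
    finally show ?thesis by (simp add: mult.commute)
  qed
  then show ?thesis by (rule that)
qed

lemma forward_sum_apply:
  "apply_bcontfun (forward_sum l c) k = (\<Sum>j<k. (l ^^ (k - Suc j)) (c j))"
proof -
  obtain C where "\<And>c k. norm (\<Sum>j<k. (l ^^ (k - Suc j)) (apply_bcontfun c j)) \<le> norm c * C"
    using forward_sum_bound by blast
  then show ?thesis unfolding forward_sum_def by (subst apply_Bcontfun_nat) auto
qed

lemma bounded_linear_forward_sum: "bounded_linear (forward_sum l)"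
proof -
  obtain C where C: "\<And>c k. norm (\<Sum>j<k. (l ^^ (k - Suc j)) (apply_bcontfun c j)) \<le> norm c * C"
    using forward_sum_bound by blast
  have lin: "linear (l ^^ k)" for k using l by (auto simp: summable_powers_def intro: linear_funpow)
  show ?thesis
    by (rule bounded_linear_bseqI[OF forward_sum_apply _ _ C])
      (simp_all add: linear_add[OF lin] linear_scale[OF lin] sum.distrib scaleR_sum_right)
qed

lemma forward_sum_0: "apply_bcontfun (forward_sum l c) 0 = 0"
  by (simp add: forward_sum_apply)

lemma forward_sum_Suc: "apply_bcontfun (forward_sum l c) (Suc k) = l (forward_sum l c k) + c k"
proof -
  have lin: "linear l" using l by (simp add: summable_powers_def)
  have "(\<Sum>j<k. (l ^^ (Suc k - Suc j)) (c j)) = (\<Sum>j<k. l ((l ^^ (k - Suc j)) (c j)))"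
    by (rule sum.cong) (simp_all flip: funpow.simps(2)[THEN fun_cong, unfolded o_apply] add: Suc_diff_Suc)
  then show ?thesis by (simp add: forward_sum_apply linear_sum[OF lin] del: diff_Suc_Suc)
qed

lemma backward_sum_summable:
  obtains C where "\<And>c k. summable (\<lambda>j. (l ^^ j) (apply_bcontfun c (k + j)))"
    "\<And>c k. norm (\<Sum>j. (l ^^ j) (apply_bcontfun c (k + j))) \<le> norm c * C"
proof -
  obtain a where a: "linear l" "summable a" "\<And>k. a k \<ge> 0" "\<And>k x. norm ((l ^^ k) x) \<le> a k * norm x"
    using summable_powersE[OF l] by blast
  have le: "norm ((l ^^ j) (apply_bcontfun c (k + j))) \<le> norm c * a j" for c k j
    by (metis a(3,4) norm_bounded mult_left_mono order_trans mult.commute)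
  have s: "summable (\<lambda>j. norm ((l ^^ j) (apply_bcontfun c (k + j))))" for c k
    by (rule summable_comparison_test'[OF summable_mult[OF a(2), of "norm c"], of 0]) (simp add: le)
  have "norm (\<Sum>j. (l ^^ j) (apply_bcontfun c (k + j))) \<le> norm c * suminf a" for c k
  proof -
    have "norm (\<Sum>j. (l ^^ j) (apply_bcontfun c (k + j))) \<le> (\<Sum>j. norm c * a j)"
      by (rule order_trans[OF summable_norm[OF s] suminf_le[OF le s summable_mult[OF a(2)]]])
    then show ?thesis by (simp add: suminf_mult[OF a(2)])
  qed
  with summable_norm_cancel[OF s] show ?thesis by (rule that)
qed

lemma backward_sum_apply:
  "apply_bcontfun (backward_sum l c) k = (\<Sum>j. (l ^^ j) (c (k + j)))"
proof -
  obtain C where C: "\<And>c k. summable (\<lambda>j. (l ^^ j) (apply_bcontfun c (k + j)))"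
    "\<And>c k. norm (\<Sum>j. (l ^^ j) (apply_bcontfun c (k + j))) \<le> norm c * C"
    using backward_sum_summable by blast
  from C(2) show ?thesis unfolding backward_sum_def by (subst apply_Bcontfun_nat) auto
qed

lemma bounded_linear_backward_sum: "bounded_linear (backward_sum l)"
proof -
  obtain C where C: "\<And>c k. summable (\<lambda>j. (l ^^ j) (apply_bcontfun c (k + j)))"
    "\<And>c k. norm (\<Sum>j. (l ^^ j) (apply_bcontfun c (k + j))) \<le> norm c * C"
    using backward_sum_summable by blast
  have lin: "linear (l ^^ k)" for k using l by (auto simp: summable_powers_def intro: linear_funpow)
  show ?thesis
    by (rule bounded_linear_bseqI[OF backward_sum_apply _ _ C(2)])
      (simp_all add: linear_add[OF lin] linear_scale[OF lin] suminf_add C(1) suminf_scaleR_right)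
qed

lemma backward_sum_rec: "apply_bcontfun (backward_sum l c) k = c k + l (backward_sum l c (Suc k))"
proof -
  obtain C where C: "\<And>c k. summable (\<lambda>j. (l ^^ j) (apply_bcontfun c (k + j)))"
    "\<And>c k. norm (\<Sum>j. (l ^^ j) (apply_bcontfun c (k + j))) \<le> norm c * C"
    using backward_sum_summable by blast
  obtain a where a: "linear l" "summable a" "\<And>k. a k \<ge> 0" "\<And>k x. norm ((l ^^ k) x) \<le> a k * norm x"
    using summable_powersE[OF l] by blast
  have "bounded_linear l"
    using a(4)[of 1] by (intro bounded_linear_intro[where K = "a 1"])
      (auto simp: linear_add[OF a(1)] linear_scale[OF a(1)] mult.commute)
  then have "l (\<Sum>j. (l ^^ j) (c (Suc k + j))) = (\<Sum>j. l ((l ^^ j) (c (Suc k + j))))"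
    using C(1) by (rule bounded_linear.suminf)
  then show ?thesis
    using suminf_split_head[OF C(1)[of c k]] by (simp add: backward_sum_apply algebra_simps)
qed

lemma free_orbit_bound: obtains C where "\<And>p k. norm ((l ^^ k) p) \<le> norm p * C"
proof -
  obtain a where a: "linear l" "summable a" "\<And>k. a k \<ge> 0" "\<And>k x. norm ((l ^^ k) x) \<le> a k * norm x"
    using summable_powersE[OF l] by blast
  have "a k \<le> suminf a" for k using sum_le_suminf[OF a(2), of "{k}"] a(3) by simp
  then show ?thesis using a(4) that by (metis mult.commute mult_left_mono norm_ge_zero order_trans)
qed

lemma free_orbit_apply: "apply_bcontfun (free_orbit l p) k = (l ^^ k) p"
proof -
  obtain C where "\<And>p k. norm ((l ^^ k) p) \<le> norm p * C" using free_orbit_bound by blast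
  then show ?thesis unfolding free_orbit_def by (subst apply_Bcontfun_nat) auto
qed

lemma bounded_linear_free_orbit: "bounded_linear (free_orbit l)"
proof -
  obtain C where C: "\<And>p k. norm ((l ^^ k) p) \<le> norm p * C" using free_orbit_bound by blast
  have lin: "linear (l ^^ k)" for k using l by (auto simp: summable_powers_def intro: linear_funpow)
  show ?thesis
    by (rule bounded_linear_bseqI[OF free_orbit_apply _ _ C])
      (simp_all add: linear_add[OF lin] linear_scale[OF lin])
qed

lemma powers_small:
  assumes "e > 0" obtains m where "m > 0" "\<And>x. norm ((l ^^ m) x) \<le> e * norm x"
proof -
  obtain a where a: "linear l" "summable a" "\<And>k. a k \<ge> 0" "\<And>k x. norm ((l ^^ k) x) \<le> a k * norm x"
    using summable_powersE[OF l] by blast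
  have "\<forall>\<^sub>F k in sequentially. a k < e \<and> k > 0"
    using order_tendstoD(2)[OF summable_LIMSEQ_zero[OF a(2)] assms] eventually_gt_at_top
    by (rule eventually_conj)
  then obtain m where m: "a m < e \<and> m > 0"
    using eventually_happens'[OF sequentially_bot] by blast
  show ?thesis
  proof (rule that[of m])
    show "norm ((l ^^ m) x) \<le> e * norm x" for x
      using a(4)[of m x] mult_right_mono[of "a m" e "norm x"] m by simp
  qed (use m in simp)
qed

end

section \<open>The stable manifold of a split system\<close>

text \<open>
  The sequence decays geometrically along the multiples of \<open>m\<close>, and the constant \<open>C\<close> bounds it in between.
\<close>
lemma null_sequence_of_block_decay:
  fixes a :: "nat \<Rightarrow> real"
  assumes "\<And>k. a k \<ge> 0" "\<And>k. a (k + m) \<le> a k / 2" "\<And>k j. a (k + j) \<le> C * a k" "C \<ge> 0"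
  shows "a \<longlonglongrightarrow> 0"
proof (rule LIMSEQ_I)
  fix e :: real assume "e > 0"
  have pow: "a (n * m) \<le> a 0 * (1/2) ^ n" for n
  proof (induction n)
    case (Suc n)
    then show ?case using assms(2)[of "n * m"] by (simp add: add.commute)
  qed simp
  have "(\<lambda>n. C * (a 0 * (1/2) ^ n)) \<longlonglongrightarrow> 0"
    by (intro tendsto_mult_right_zero LIMSEQ_power_zero) simp
  from LIMSEQ_D[OF this \<open>e > 0\<close>] obtain n where "norm (C * (a 0 * (1/2) ^ n) - 0) < e" by blast
  then have n: "C * (a 0 * (1/2) ^ n) < e" by simp
  have "norm (a k - 0) < e" if "k \<ge> n * m" for k
  proof -
    have "a k \<le> C * a (n * m)" using assms(3)[of "n * m" "k - n * m"] that by simp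
    also have "\<dots> \<le> C * (a 0 * (1/2) ^ n)" by (rule mult_left_mono[OF pow assms(4)])
    finally show ?thesis using n assms(1)[of k] by simp
  qed
  then show "\<exists>no. \<forall>k\<ge>no. norm (a k - 0) < e" by blast
qed

lemma superpose_shift:
  assumes "continuous_on UNIV \<phi>"
  shows "superpose \<phi> (shift y) = shift (superpose \<phi> y)"
  by (rule bcontfun_eqI) (simp add: superpose_apply[OF assms])

lemma shift_funpow_apply: "apply_bcontfun ((shift ^^ k) y) j = y (k + j)"
  by (induction k arbitrary: j) simp_all

text \<open>
  The manifold is obtained from \<open>solution_map\<close> for the sequence \<open>y\<^sub>k = (x\<^sub>k, P x\<^bsub>k+1\<^esub> + z\<^bsub>k+1\<^esub>)\<close>, at which
  \<open>\<phi>\<close> is evaluated without any shift of the index. Given \<open>c\<^sub>k = \<phi>(y\<^sub>k)\<close>, first \<open>z\<close> is a backward sum of \<open>hl c\<close>,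
  and then \<open>x\<close> the orbit of \<open>p\<close> plus a forward sum of \<open>ml c - ns z\<^sup>+\<close>; the coupling \<open>ns\<close> acts in one direction only and
  can thus have any size. The function \<open>\<psi>\<close> assigns to \<open>p\<close> the first entry of \<open>z\<close>. The graph is
  invariant because the equation for the shifted sequence is the same equation with \<open>x\<^sub>1\<close> in place of \<open>p\<close>.
\<close>
lemma stable_manifold_of_split_system:
  fixes l lt P ns :: "'e::euclidean_space \<Rightarrow> 'e" and ml hl :: "'e \<times> 'e \<Rightarrow> 'e"
    and \<phi> :: "'e \<times> 'e \<Rightarrow> 'e \<times> 'e"
  assumes l: "summable_powers l" and lt: "summable_powers lt"
    and P: "bounded_linear P" and ns: "bounded_linear ns"
    and ml: "bounded_linear ml" and hl: "bounded_linear hl"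
    and \<phi>: "Ck_on r UNIV \<phi>" "r \<ge> 1" "\<phi> 0 = 0" "(\<phi> has_derivative (\<lambda>_. 0)) (at 0)"
  obtains \<rho> \<sigma> \<psi> where "\<rho> > 0" "\<sigma> > 0" "\<sigma> \<le> \<rho>"
    "Ck_on r (ball 0 \<rho>) \<psi>" "\<psi> 0 = 0" "(\<psi> has_derivative (\<lambda>_. 0)) (at 0)"
    "\<And>p. p \<in> ball 0 \<sigma> \<Longrightarrow> \<exists>x. x 0 = p \<and> (\<forall>k. x k \<in> ball 0 \<rho>) \<and> x \<longlonglongrightarrow> 0 \<and>
      (\<forall>k. x (Suc k) = l (x k) + ml (\<phi> (x k, P (x (Suc k)) + \<psi> (x (Suc k)))) - ns (\<psi> (x (Suc k))) \<and>
           \<psi> (x k) = lt (\<psi> (x (Suc k))) + hl (\<phi> (x k, P (x (Suc k)) + \<psi> (x (Suc k)))))"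
proof -
  have \<phi>c: "continuous_on UNIV \<phi>" by (rule Ck_on_continuous_on[OF \<phi>(1)])
  note cont = linear_continuous_on
  define Z where "Z c = backward_sum lt (superpose hl c)" for c
  define X where "X c = forward_sum l (superpose ml c - superpose ns (shift (Z c)))" for c
  \<comment> \<open>\<open>J x + J' z\<close> is the sequence \<open>(x\<^sub>k, P x\<^bsub>k+1\<^esub> + z\<^bsub>k+1\<^esub>)\<close>.\<close>
  define J where "J x = superpose (\<lambda>x. (x, 0)) x + superpose (\<lambda>x. (0, P x)) (shift x)" for x
  define J' where "J' z = superpose (\<lambda>z. (0 :: 'e, z :: 'e)) (shift z)" for z
  define Lo where "Lo p = J (free_orbit l p)" for p
  define Go where "Go c = J (X c) + J' (Z c)" for c
  have pairs: "bounded_linear (\<lambda>x. (x :: 'e, 0 :: 'e))" "bounded_linear (\<lambda>x. (0 :: 'e, x :: 'e))"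
    "bounded_linear (\<lambda>x. (0 :: 'e, P x))"
    by (intro bounded_linear_Pair bounded_linear_ident bounded_linear_zero P)+
  note bl = bounded_linear_superpose bounded_linear_shift bounded_linear_forward_sum[OF l]
    bounded_linear_backward_sum[OF lt]
  have Z: "bounded_linear Z" unfolding Z_def
    by (intro bounded_linear_compose[OF bl(4)] bl hl)
  have X: "bounded_linear X" unfolding X_def
    by (intro bounded_linear_compose[OF bl(3)] bounded_linear_sub bl(1) ml
        bounded_linear_compose[OF bl(1)[OF ns]] bounded_linear_compose[OF bl(2)] Z)
  have J: "bounded_linear J" unfolding J_def
    by (intro bounded_linear_add bl(1) pairs bounded_linear_compose[OF bl(1)[OF pairs(3)]] bl(2))
  have J': "bounded_linear J'" unfolding J'_def
    by (intro bounded_linear_compose[OF bl(1)[OF pairs(2)]] bl(2))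
  have Lo: "bounded_linear Lo" unfolding Lo_def
    by (intro bounded_linear_compose[OF J] bounded_linear_free_orbit l)
  have Go: "bounded_linear Go" unfolding Go_def
    by (intro bounded_linear_add bounded_linear_compose[OF J] bounded_linear_compose[OF J'] X Z)
  have J_apply: "apply_bcontfun (J x) k = (x k, P (x (Suc k)))" for x k
    by (simp add: J_def superpose_apply cont pairs)
  have J'_apply: "apply_bcontfun (J' z) k = (0, z (Suc k))" for z k
    by (simp add: J'_def superpose_apply cont pairs)
  define xs where "xs p c k = (l ^^ k) p + apply_bcontfun (X c) k" for p c k
  have sol: "apply_bcontfun (Lo p + Go c) k = (xs p c k, P (xs p c (Suc k)) + Z c (Suc k))" for p c k
    using bounded_linear.linear[OF P, THEN linear_add]
    by (simp add: Lo_def Go_def J_apply J'_apply xs_def free_orbit_apply[OF l] del: funpow.simps)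
  have linl: "linear l" using l by (simp add: summable_powers_def)
  have xs_0: "xs p c 0 = p" for p c by (simp add: xs_def X_def forward_sum_0[OF l])
  have xs_Suc: "xs p c (Suc k) = l (xs p c k) + ml (c k) - ns (Z c (Suc k))" for p c k
    by (simp add: xs_def X_def forward_sum_Suc[OF l] superpose_apply cont ml ns linear_add[OF linl])
  have Z_rec: "Z c k = lt (Z c (Suc k)) + hl (c k)" for c k
    unfolding Z_def by (subst backward_sum_rec[OF lt]) (simp add: superpose_apply cont hl)
  have Z_shift: "Z (shift c) = shift (Z c)" for c
    unfolding Z_def superpose_shift[OF cont[OF hl]]
    by (rule bcontfun_eqI) (simp add: backward_sum_apply[OF lt])
  have xs_shift: "xs (xs p c 1) (shift c) k = xs p c (Suc k)" for p c k
    by (induction k) (simp_all add: xs_0 xs_Suc Z_shift)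
  have sol_shift: "shift (Lo p + Go c) = Lo (xs p c 1) + Go (shift c)" for p c
    by (rule bcontfun_eqI) (simp add: sol xs_shift Z_shift del: plus_bcontfun.rep_eq One_nat_def)
  obtain CL where CL: "CL \<ge> 0" "\<And>p. norm (Lo p) \<le> CL * norm p"
    using bounded_linear.nonneg_bounded[OF Lo] by (metis mult.commute)
  obtain CX where CX: "CX \<ge> 0" "\<And>c. norm (X c) \<le> norm c * CX"
    using bounded_linear.nonneg_bounded[OF X] by blast
  \<comment> \<open>The nonlinearity has to be so small that it adds at most \<open>1/4\<close> to the contraction of \<open>l ^^ m\<close>.\<close>
  define d where "d = (CX + 1) * (CL + 1)"
  have d: "d > 0" unfolding d_def using CL(1) CX(1) by (intro mult_pos_pos) auto
  have "CL * CX \<le> d" using CL(1) CX(1) by (simp add: d_def algebra_simps)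
  define \<eta> where "\<eta> = 1 / (8 * d)"
  have \<eta>: "\<eta> > 0" "2 * CL * \<eta> * CX \<le> 1 / 4" using d \<open>CL * CX \<le> d\<close> by (simp_all add: \<eta>_def field_simps)
  obtain \<delta> \<rho> u where \<delta>: "\<delta> > 0" and \<rho>: "\<rho> > 0"
    and u_norm: "\<And>p. p \<in> ball 0 \<rho> \<Longrightarrow> norm (u p) \<le> \<delta>"
    and u_eq: "\<And>p. p \<in> ball 0 \<rho> \<Longrightarrow> u p = Lo p + Go (superpose \<phi> (u p))"
    and u_unique: "\<And>p y. p \<in> ball 0 \<rho> \<Longrightarrow> norm y \<le> \<delta> \<Longrightarrow> y = Lo p + Go (superpose \<phi> y) \<Longrightarrow> y = u p"
    and u_le: "\<And>p. p \<in> ball 0 \<rho> \<Longrightarrow> norm (u p) \<le> 2 * CL * norm p"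
    and small: "\<And>y. norm y \<le> \<delta> \<Longrightarrow> norm (superpose \<phi> y) \<le> \<eta> * norm y"
    and u_Ck: "Ck_on r (ball 0 \<rho>) u"
    by (rule solution_map[OF Lo CL Go \<phi> \<eta>(1)]) (rule that; assumption)
  define \<psi> where "\<psi> p = apply_bcontfun (Z (superpose \<phi> (u p))) 0" for p
  have \<Lambda>: "bounded_linear (\<lambda>c. apply_bcontfun (Z c) 0)"
    by (rule bounded_linear_compose[OF bounded_linear_apply_bcontfun Z])
  have \<psi>_Ck: "Ck_on r (ball 0 \<rho>) \<psi>" unfolding \<psi>_def
    by (intro Ck_on_linear_compose[OF \<Lambda>] Ck_on_superpose open_ball \<phi> u_Ck)
  have u0: "u 0 = 0" using u_le[of 0] \<rho> by simp
  have sup0: "superpose \<phi> 0 = 0" by (rule bcontfun_eqI) (simp add: superpose_apply[OF \<phi>c] \<phi>(3))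
  have \<psi>0: "\<psi> 0 = 0" by (simp add: \<psi>_def u0 sup0 linear_0[OF bounded_linear.linear[OF Z]])
  have \<psi>_der: "(\<psi> has_derivative (\<lambda>_. 0)) (at 0)"
  proof -
    obtain r' where r': "r = Suc r'" using \<phi>(2) by (cases r) auto
    obtain \<phi>' where \<phi>': "\<And>x. (\<phi> has_derivative \<phi>' x) (at x)" "\<And>v. Ck_on r' UNIV (\<lambda>x. \<phi>' x v)"
      using Ck_on_UNIV_SucE[OF \<phi>(1)[unfolded r']] by blast
    note sd = superpose_has_derivative[OF \<phi>'(1) Ck_on_continuous_on[OF \<phi>'(2)]]
    have \<phi>'0: "\<phi>' 0 v = 0" for v using has_derivative_unique[OF \<phi>'(1) \<phi>(4)] by metis
    have "(\<Sum>b\<in>Basis. basis_mult b w (superpose (\<lambda>x. \<phi>' x b) (u 0))) = 0" for w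
      by (rule bcontfun_eqI) (simp add: sd(2) u0 \<phi>'0)
    then have "(superpose \<phi> has_derivative (\<lambda>_. 0)) (at (u 0))" using sd(1)[of "u 0"] by simp
    moreover have "u differentiable (at 0)" using u_Ck \<rho> by (simp add: r')
    then obtain u' where "(u has_derivative u') (at 0)" unfolding differentiable_def ..
    ultimately have "((\<lambda>p. superpose \<phi> (u p)) has_derivative (\<lambda>_. 0)) (at 0)"
      using diff_chain_at[of u u' 0 "superpose \<phi>" "\<lambda>_. 0"] by (simp add: o_def)
    from bounded_linear.has_derivative[OF \<Lambda> this] show ?thesis
      by (simp add: \<psi>_def[abs_def] linear_0[OF bounded_linear.linear[OF Z]])
  qed
  obtain m where m: "m > 0" "\<And>x. norm ((l ^^ m) x) \<le> (1/4) * norm x"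
    using powers_small[OF l, of "1/4"] by auto
  \<comment> \<open>Trajectories starting in the smaller ball of radius \<open>\<sigma>\<close> remain in the domain of \<open>\<psi>\<close>.\<close>
  define \<sigma> where "\<sigma> = \<rho> / (2 * CL + 1)"
  have \<sigma>: "\<sigma> > 0" "\<sigma> \<le> \<rho>" "2 * CL * \<sigma> \<le> \<rho>"
    using CL(1) \<rho> by (auto simp: \<sigma>_def field_simps)
  have traj: "\<exists>x. x 0 = p \<and> (\<forall>k. x k \<in> ball 0 \<rho>) \<and> x \<longlonglongrightarrow> 0 \<and>
      (\<forall>k. x (Suc k) = l (x k) + ml (\<phi> (x k, P (x (Suc k)) + \<psi> (x (Suc k)))) - ns (\<psi> (x (Suc k))) \<and>
           \<psi> (x k) = lt (\<psi> (x (Suc k))) + hl (\<phi> (x k, P (x (Suc k)) + \<psi> (x (Suc k)))))"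
    if p\<sigma>: "p \<in> ball 0 \<sigma>" for p
  proof -
    have p: "p \<in> ball 0 \<rho>" using p\<sigma> \<sigma>(2) by auto
    define c where "c = superpose \<phi> (u p)"
    define x where "x = xs p c"
    have up: "u p = Lo p + Go c" unfolding c_def by (rule u_eq[OF p])
    have u_apply: "apply_bcontfun (u p) k = (x k, P (x (Suc k)) + Z c (Suc k))" for k
      unfolding up sol x_def ..
    have x_le: "norm (x k) \<le> norm (u p)" for k
      using norm_bounded[of "u p" k] norm_fst_le[of "x k"] unfolding u_apply by (meson order_trans)
    have "2 * CL * norm p \<le> 2 * CL * \<sigma>" using p\<sigma> CL(1) by (intro mult_left_mono) auto
    have x_ball: "x k \<in> ball 0 \<rho>" for k
    proof (cases "CL = 0")
      case True
      then show ?thesis using x_le[of k] u_le[OF p] \<rho> by simp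
    next
      case False
      then have "2 * CL * norm p < 2 * CL * \<sigma>" using p\<sigma> CL(1) by simp
      then show ?thesis using x_le[of k] u_le[OF p] \<sigma>(3) by simp
    qed
    \<comment> \<open>By uniqueness the \<open>k\<close>-fold shift of the trajectory is the trajectory that starts at \<open>x k\<close>.\<close>
    have shifted: "(shift ^^ k) (u p) = u (x k) \<and> norm ((shift ^^ k) (u p)) \<le> \<delta>" for k
    proof (induction k)
      case 0
      then show ?case using u_norm[OF p] by (simp add: x_def xs_0)
    next
      case (Suc k)
      let ?y = "(shift ^^ k) (u p)"
      have y: "?y = u (x k)" using Suc by blast
      have le: "norm (shift ?y) \<le> \<delta>" by (rule order_trans[OF norm_shift_le conjunct2[OF Suc]])
      have eq: "?y = Lo (x k) + Go (superpose \<phi> ?y)"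
        unfolding y by (rule u_eq[OF x_ball])
      have "xs (x k) (superpose \<phi> ?y) 1 = fst (apply_bcontfun ?y 1)"
        by (subst (2) eq) (simp only: sol fst_conv)
      also have "\<dots> = x (Suc k)" by (simp add: shift_funpow_apply u_apply)
      finally have x1: "xs (x k) (superpose \<phi> ?y) 1 = x (Suc k)" .
      have "shift ?y = shift (Lo (x k) + Go (superpose \<phi> ?y))"
        by (rule arg_cong[OF eq])
      also have "\<dots> = Lo (x (Suc k)) + Go (superpose \<phi> (shift ?y))"
        unfolding sol_shift x1 superpose_shift[OF \<phi>c] ..
      finally have "shift ?y = u (x (Suc k))" by (rule u_unique[OF x_ball le])
      then show ?case using le by simp
    qed
    have \<psi>x: "\<psi> (x k) = Z c k" for k
    proof -
      have "superpose \<phi> ((shift ^^ k) (u p)) = (shift ^^ k) c"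
        by (induction k) (simp_all add: c_def superpose_shift[OF \<phi>c])
      moreover have "Z ((shift ^^ k) c) = (shift ^^ k) (Z c)" by (induction k) (simp_all add: Z_shift)
      moreover have "u (x k) = (shift ^^ k) (u p)" using shifted[of k] by simp
      ultimately show ?thesis by (simp add: \<psi>_def shift_funpow_apply)
    qed
    have c_apply: "c k = \<phi> (x k, P (x (Suc k)) + \<psi> (x (Suc k)))" for k
      by (simp add: c_def superpose_apply[OF \<phi>c] u_apply \<psi>x)
    have x_forward: "norm (x (k + j)) \<le> 2 * CL * norm (x k)" for k j
    proof -
      have "norm (x (k + j)) \<le> norm (apply_bcontfun ((shift ^^ k) (u p)) j)"
        using norm_fst_le[of "x (k + j)"] by (simp add: shift_funpow_apply u_apply)
      also have "\<dots> \<le> norm (u (x k))" using shifted[of k] norm_bounded by metis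
      also have "\<dots> \<le> 2 * CL * norm (x k)" by (rule u_le[OF x_ball])
      finally show ?thesis .
    qed
    have x_decay: "norm (x (k + m)) \<le> norm (x k) / 2" for k
    proof -
      let ?c = "superpose \<phi> (u (x k))"
      have "x (k + m) = fst (apply_bcontfun ((shift ^^ k) (u p)) m)"
        by (simp add: shift_funpow_apply u_apply)
      also have "\<dots> = fst (apply_bcontfun (Lo (x k) + Go ?c) m)"
        using shifted[of k] u_eq[OF x_ball[of k]] by metis
      also have "\<dots> = (l ^^ m) (x k) + X ?c m" unfolding sol xs_def by simp
      finally have "norm (x (k + m)) \<le> norm ((l ^^ m) (x k)) + norm (X ?c m)"
        by (simp add: norm_triangle_ineq)
      also have "norm (X ?c m) \<le> norm ?c * CX" by (rule order_trans[OF norm_bounded CX(2)])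
      also have "norm ?c * CX \<le> (\<eta> * (2 * CL * norm (x k))) * CX"
        using small[OF u_norm[OF x_ball[of k]]] u_le[OF x_ball[of k]] \<eta>(1) CX(1)
        by (intro mult_right_mono) (auto intro: order_trans mult_left_mono)
      also have "\<dots> = (2 * CL * \<eta> * CX) * norm (x k)" by simp
      also have "\<dots> \<le> (1/4) * norm (x k)" by (rule mult_right_mono[OF \<eta>(2)]) simp
      also have "norm ((l ^^ m) (x k)) \<le> (1/4) * norm (x k)" by (rule m(2))
      finally show ?thesis by simp
    qed
    have "(\<lambda>k. norm (x k)) \<longlonglongrightarrow> 0"
      by (rule null_sequence_of_block_decay[where a = "\<lambda>k. norm (x k)" and m = m and C = "2 * CL"])
        (use x_decay x_forward CL(1) in auto)
    then have lim: "x \<longlonglongrightarrow> 0" by (rule tendsto_norm_zero_cancel)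
    have fwd: "x (Suc k) = l (x k) + ml (c k) - ns (\<psi> (x (Suc k)))" for k
      unfolding \<psi>x unfolding x_def by (rule xs_Suc)
    have bwd: "\<psi> (x k) = lt (\<psi> (x (Suc k))) + hl (c k)" for k
      unfolding \<psi>x by (rule Z_rec)
    have "x 0 = p" unfolding x_def by (rule xs_0)
    with x_ball lim fwd bwd show ?thesis unfolding c_apply by blast
  qed
  show ?thesis by (rule that[OF \<rho> \<sigma>(1,2) \<psi>_Ck \<psi>0 \<psi>_der traj])
qed

section \<open>Powers of a matrix with spectrum in the open unit disc\<close>

lemma norm_vector_smult: "norm (c *s (x :: complex^'n)) = cmod c * norm x"
  by (simp add: norm_vec_def norm_mult L2_set_right_distrib)

text \<open>
  The vector \<open>p(M) v\<close>, by Horner recursion on \<open>p\<close>.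
\<close>
definition poly_mat_vec :: "complex poly \<Rightarrow> complex^'n^'n \<Rightarrow> complex^'n \<Rightarrow> complex^'n" where
  "poly_mat_vec p M = fold_coeffs (\<lambda>a f v. a *s v + f (M *v v)) p (\<lambda>v. 0)"

lemma poly_mat_vec_0 [simp]: "poly_mat_vec 0 M v = 0"
  by (simp add: poly_mat_vec_def)

lemma poly_mat_vec_pCons [simp]:
  "poly_mat_vec (pCons a p) M v = a *s v + poly_mat_vec p M (M *v v)"
proof (cases "p = 0 \<and> a = 0")
  case False
  then show ?thesis by (auto simp: poly_mat_vec_def)
qed simp

lemma poly_mat_vec_add_poly:
  "poly_mat_vec (p + q) M v = poly_mat_vec p M v + poly_mat_vec q M v"
  by (induction p q arbitrary: v rule: poly_induct2) (simp_all add: vector_sadd_rdistrib)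

lemma poly_mat_vec_smult: "poly_mat_vec (smult c p) M v = c *s poly_mat_vec p M v"
  by (induction p arbitrary: v) (simp_all add: vector_ssub_ldistrib vector_add_ldistrib vector_smult_assoc)

lemma poly_mat_vec_diff: "poly_mat_vec p M (v - w) = poly_mat_vec p M v - poly_mat_vec p M w"
  by (induction p arbitrary: v w) (simp_all add: matrix_vector_mult_diff_distrib vector_ssub_ldistrib)

lemma poly_mat_vec_scale: "poly_mat_vec p M (c *s v) = c *s poly_mat_vec p M v"
  by (induction p arbitrary: v)
    (simp_all add: vector_scalar_commute vector_add_ldistrib vector_smult_assoc mult.commute)

lemma poly_mat_vec_commute: "poly_mat_vec p M (M *v v) = M *v poly_mat_vec p M v"
  by (induction p arbitrary: v) (simp_all add: vector_scalar_commute matrix_vector_right_distrib)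

lemma poly_mat_vec_linear_factor:
  "poly_mat_vec ([:-\<mu>, 1:] * q) M v = poly_mat_vec q M (M *v v - \<mu> *s v)"
  by (simp add: poly_mat_vec_add_poly poly_mat_vec_smult poly_mat_vec_diff poly_mat_vec_scale
      vector_sneg_minus1[symmetric] flip: smult_minus_left)

lemma poly_mat_vec_monom: "poly_mat_vec (monom c i) M v = c *s (((*v) M ^^ i) v)"
  by (induction i arbitrary: v) (simp_all add: monom_0 monom_Suc funpow_swap1)

lemma poly_mat_vec_sum: "poly_mat_vec (\<Sum>i\<in>I. f i) M v = (\<Sum>i\<in>I. poly_mat_vec (f i) M v)"
  by (induction I rule: infinite_finite_induct) (simp_all add: poly_mat_vec_add_poly)

text \<open>
  The \<open>n + 1\<close> vectors \<open>v, M v, \<dots>, M\<^sup>n v\<close> are linearly dependent; if two of them coincide, the difference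
  of two monomials does the job.
\<close>
lemma annihilating_poly:
  fixes M :: "complex^'n^'n"
  obtains p where "p \<noteq> 0" "poly_mat_vec p M v = 0"
proof (cases "inj_on (\<lambda>i. ((*v) M ^^ i) v) {..CARD('n)}")
  case True
  let ?f = "\<lambda>i. ((*v) M ^^ i) v"
  let ?S = "?f ` {..CARD('n)}"
  have "card ?S = Suc (CARD('n))" by (simp add: card_image[OF True])
  then have "vec.dependent ?S"
    using vec.independent_card_le_dim[of ?S UNIV] vec_dim_card[where 'a = complex and 'n = 'n]
    by (auto simp del: vec.dim_UNIV)
  then obtain u where u: "\<exists>x\<in>?S. u x \<noteq> 0" "(\<Sum>x\<in>?S. u x *s x) = 0"
    by (subst (asm) vec.dependent_finite) auto
  let ?p = "\<Sum>i\<le>CARD('n). monom (u (?f i)) i"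
  obtain i where i: "i \<le> CARD('n)" "u (?f i) \<noteq> 0" using u(1) by auto
  have "coeff ?p i = u (?f i)" using i(1) by (simp add: coeff_sum)
  then have "?p \<noteq> 0" using i(2) by (metis coeff_0)
  moreover have "poly_mat_vec ?p M v = 0"
    using u(2) by (simp add: poly_mat_vec_sum poly_mat_vec_monom sum.reindex[OF True])
  ultimately show ?thesis by (rule that)
next
  case False
  then obtain i j where ij: "i \<noteq> j" "((*v) M ^^ i) v = ((*v) M ^^ j) v" by (auto simp: inj_on_def)
  let ?p = "monom 1 i + monom (-1) j :: complex poly"
  have "coeff ?p i = 1" using ij(1) by simp
  then have "?p \<noteq> 0" by (metis coeff_0 zero_neq_one)
  moreover have "poly_mat_vec ?p M v = 0"
    using ij(2) by (simp add: poly_mat_vec_add_poly poly_mat_vec_monom vector_sneg_minus1[symmetric])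
  ultimately show ?thesis by (rule that)
qed

text \<open>
  Summing the recursion, the partial sums \<open>s\<close> satisfy \<open>s \<le> a\<^sub>0 + q s + \<Sum> b\<close>.
\<close>
lemma summable_of_contractive_recursion:
  fixes a b :: "nat \<Rightarrow> real"
  assumes "\<And>k. a (Suc k) \<le> q * a k + b k" "\<And>k. a k \<ge> 0" "\<And>k. b k \<ge> 0" "summable b" "0 \<le> q" "q < 1"
  shows "summable a"
proof (rule summableI_nonneg_bounded[OF assms(2)])
  fix n
  have le: "(\<Sum>k<n. a k) \<le> a 0 + q * (\<Sum>k<n. a k) + suminf b"
  proof (cases n)
    case 0
    then show ?thesis using assms(2)[of 0] suminf_nonneg[OF assms(4,3)] by simp
  next
    case (Suc m)
    have "(\<Sum>k<n. a k) = a 0 + (\<Sum>k<m. a (Suc k))"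
      unfolding Suc by (rule sum.lessThan_Suc_shift)
    also have "(\<Sum>k<m. a (Suc k)) \<le> (\<Sum>k<m. q * a k + b k)" by (intro sum_mono assms(1))
    also have "\<dots> = q * (\<Sum>k<m. a k) + (\<Sum>k<m. b k)" by (simp add: sum.distrib sum_distrib_left)
    also have "(\<Sum>k<m. b k) \<le> suminf b" by (intro sum_le_suminf assms) auto
    also have "q * (\<Sum>k<m. a k) \<le> q * (\<Sum>k<n. a k)"
      unfolding Suc using assms(2,5) by (intro mult_left_mono) auto
    finally show ?thesis by simp
  qed
  then have "(1 - q) * (\<Sum>k<n. a k) \<le> a 0 + suminf b" by (simp add: algebra_simps)
  then show "(\<Sum>k<n. a k) \<le> (a 0 + suminf b) / (1 - q)"
    using assms(6) by (simp add: field_simps)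
qed

lemma funpow_mult_vec_linear:
  fixes M :: "complex^'n^'n"
  shows "((*v) M ^^ k) (v - c *s w) = ((*v) M ^^ k) v - c *s ((*v) M ^^ k) w"
  by (induction k) (simp_all add: matrix_vector_mult_diff_distrib vector_scalar_commute)

text \<open>
  Induction on the degree of a polynomial with \<open>p(M) v = 0\<close>, splitting off a root \<open>\<mu>\<close> as \<open>p = (X - \<mu>) q\<close>. If
  \<open>\<mu>\<close> is an eigenvalue, then \<open>q\<close> annihilates \<open>w = M v - \<mu> v\<close>, and \<open>M\<^bsup>k+1\<^esup> v = \<mu> M\<^sup>k v + M\<^sup>k w\<close> with
  \<open>\<bar>\<mu>\<bar> < 1\<close>. Otherwise \<open>M - \<mu>\<close> is injective, and already \<open>q(M) v = 0\<close>.
\<close>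
lemma summable_complex_orbit:
  fixes M :: "complex^'n^'n"
  assumes "\<And>\<mu>. eigenvalue M \<mu> \<Longrightarrow> cmod \<mu> < 1"
    and "p \<noteq> 0" "poly_mat_vec p M v = 0"
  shows "summable (\<lambda>k. norm (((*v) M ^^ k) v))"
  using assms(2,3)
proof (induction "degree p" arbitrary: p v)
  case 0
  then obtain c where "p = [:c:]" by (metis degree_eq_zeroE)
  then have "v = 0" using 0 by (simp add: vector_mul_eq_0)
  moreover have "((*v) M ^^ k) 0 = 0" for k by (induction k) simp_all
  ultimately show ?case by simp
next
  case (Suc n)
  obtain \<mu> where "poly p \<mu> = 0"
    using fundamental_theorem_of_algebra[of p] Suc.hyps(2) by (auto simp: constant_degree)
  then obtain q where q: "p = [:-\<mu>, 1:] * q" unfolding poly_eq_0_iff_dvd dvd_def by blast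
  have q0: "q \<noteq> 0" using q Suc.prems(1) by auto
  have "degree p = 1 + degree q" unfolding q by (subst degree_mult_eq) (use q0 in auto)
  then have deg: "n = degree q" using Suc.hyps(2) by simp
  let ?w = "M *v v - \<mu> *s v"
  have w: "poly_mat_vec q M ?w = 0"
    using Suc.prems(2) unfolding q poly_mat_vec_linear_factor .
  show ?case
  proof (cases "eigenvalue M \<mu>")
    case True
    have sw: "summable (\<lambda>k. norm (((*v) M ^^ k) ?w))" by (rule Suc.hyps(1)[OF deg q0 w])
    show ?thesis
    proof (rule summable_of_contractive_recursion[OF _ _ _ sw])
      fix k
      have "((*v) M ^^ Suc k) v = \<mu> *s ((*v) M ^^ k) v + ((*v) M ^^ k) ?w"
        by (simp add: funpow_mult_vec_linear funpow_swap1)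
      then show "norm (((*v) M ^^ Suc k) v) \<le> cmod \<mu> * norm (((*v) M ^^ k) v) + norm (((*v) M ^^ k) ?w)"
        by (metis norm_triangle_ineq norm_vector_smult)
    qed (use assms(1)[OF True] in auto)
  next
    case False
    let ?x = "poly_mat_vec q M v"
    have "M *v ?x = \<mu> *s ?x"
      using w by (simp add: poly_mat_vec_diff poly_mat_vec_scale poly_mat_vec_commute)
    then have "?x = 0" using False unfolding eigenvalue_def by blast
    then show ?thesis by (rule Suc.hyps(1)[OF deg q0])
  qed
qed

definition complex_vec :: "real^'n \<Rightarrow> complex^'n" where
  "complex_vec v = (\<chi> i. complex_of_real (v $ i))"

lemma norm_complex_vec: "norm (complex_vec v) = norm v"
  by (simp add: norm_vec_def complex_vec_def)

lemma mult_complex_vec: "map_matrix complex_of_real M *v complex_vec v = complex_vec (M *v v)"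
  by (simp add: vec_eq_iff matrix_vector_mult_def complex_vec_def)

lemma funpow_complex_vec:
  fixes M :: "real^'n^'n"
  shows "((*v) (map_matrix complex_of_real M) ^^ k) (complex_vec v) = complex_vec (((*v) M ^^ k) v)"
  by (induction k) (simp_all add: mult_complex_vec)

text \<open>
  The orbits of the finitely many basis vectors are summable, and together they bound the operator norm
  of the powers.
\<close>
lemma summable_powers_matrix:
  fixes L :: "real^'n^'n"
  assumes "eigenvalues_in_unit_disc L"
  shows "summable_powers ((*v) L)"
proof -
  have orbit: "summable (\<lambda>k. norm (((*v) L ^^ k) v))" for v
  proof -
    obtain p where "p \<noteq> 0" "poly_mat_vec p (map_matrix complex_of_real L) (complex_vec v) = 0"
      by (rule annihilating_poly)
    from summable_complex_orbit[OF _ this] show ?thesis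
      using assms by (simp add: eigenvalues_in_unit_disc_def funpow_complex_vec norm_complex_vec)
  qed
  define a where "a k = (\<Sum>b\<in>Basis. norm (((*v) L ^^ k) b))" for k
  have "norm (((*v) L ^^ k) x) \<le> a k * norm x" for k x
  proof -
    have lin: "linear ((*v) L ^^ k)" by (intro linear_funpow matrix_vector_mul_linear)
    have "((*v) L ^^ k) x = ((*v) L ^^ k) (\<Sum>b\<in>Basis. (x \<bullet> b) *\<^sub>R b)" by (simp add: euclidean_representation)
    also have "\<dots> = (\<Sum>b\<in>Basis. (x \<bullet> b) *\<^sub>R ((*v) L ^^ k) b)"
      by (simp add: linear_sum[OF lin] linear_scale[OF lin])
    also have "norm \<dots> \<le> (\<Sum>b\<in>Basis. norm (((*v) L ^^ k) b) * norm x)"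
      by (rule sum_norm_le) (auto simp: mult.commute intro!: mult_right_mono Basis_le_norm)
    finally show ?thesis by (simp add: a_def sum_distrib_right)
  qed
  moreover have "summable a" unfolding a_def by (intro summable_sum orbit)
  ultimately show ?thesis unfolding summable_powers_def by auto
qed

text \<open>
  A power and its adjoint have the same operator norm, so the same majorant works.
\<close>
lemma summable_powers_transpose:
  fixes L :: "real^'n^'n"
  assumes "summable_powers ((*v) L)"
  shows "summable_powers ((*v) (transpose L))"
proof -
  obtain a where a: "linear ((*v) L)" "summable a" "\<And>k. a k \<ge> 0" "\<And>k x. norm (((*v) L ^^ k) x) \<le> a k * norm x"
    using summable_powersE[OF assms] by blast
  have adj: "((*v) (transpose L) ^^ k) x \<bullet> y = x \<bullet> ((*v) L ^^ k) y" for k and x y :: "real^'n"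
  proof (induction k arbitrary: x)
    case (Suc k)
    have "((*v) (transpose L) ^^ Suc k) x \<bullet> y = (transpose L *v x) \<bullet> ((*v) L ^^ k) y"
      by (simp only: funpow_Suc_right o_apply Suc)
    also have "\<dots> = x \<bullet> ((*v) L ^^ Suc k) y"
      using dot_lmul_matrix[of x L] by simp
    finally show ?case .
  qed simp
  have "norm (((*v) (transpose L) ^^ k) x) \<le> a k * norm x" for k and x :: "real^'n"
  proof -
    let ?y = "((*v) (transpose L) ^^ k) x"
    have "norm ?y * norm ?y = x \<bullet> ((*v) L ^^ k) ?y"
      unfolding adj[symmetric] by (simp add: power2_norm_eq_inner flip: power2_eq_square)
    also have "\<dots> \<le> norm x * (a k * norm ?y)"
      by (meson Cauchy_Schwarz_ineq2 abs_le_D1 a(4) mult_left_mono norm_ge_zero order_trans)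
    finally have "norm ?y * norm ?y \<le> (a k * norm x) * norm ?y" by (simp add: mult_ac)
    then show ?thesis
      using mult_right_le_imp_le[of "norm ?y" "norm ?y" "a k * norm x"] a(3)[of k]
      by (cases "?y = 0") auto
  qed
  with a(2) show ?thesis unfolding summable_powers_def by auto
qed

section \<open>Matrix identities of the optimal feedback\<close>

lemma invertible_of_trivial_kernel:
  fixes M :: "real^'n^'n"
  assumes "\<And>v. M *v v = 0 \<Longrightarrow> v = 0"
  shows "invertible M"
  using assms invertible_left_inverse matrix_left_invertible_ker by blast

lemma inner_transpose: "x \<bullet> (transpose M *v y) = (M *v x) \<bullet> (y :: real^'n)"
  for M :: "real^'m^'n"
  by (metis dot_lmul_matrix inner_commute vector_transpose_matrix)

lemma matrix_inv_mult:
  assumes "invertible (M :: real^'n^'n)"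
  shows "M ** matrix_inv M = mat 1" "matrix_inv M ** M = mat 1"
  using someI_ex[OF assms[unfolded invertible_def]] unfolding matrix_inv_def by blast+

lemma matrix_mult_add_rdistrib: "(A + B) ** C = A ** C + B ** (C :: real^'k^'n)"
  for A B :: "real^'n^'m"
  by (simp add: matrix_matrix_mult_def vec_eq_iff sum.distrib distrib_right)

lemma transpose_add: "transpose (A + B) = transpose A + transpose (B :: real^'n^'m)"
  by (simp add: transpose_def vec_eq_iff)

lemma transpose_minus: "transpose (- A) = - transpose (A :: real^'n^'m)"
  by (simp add: transpose_def vec_eq_iff)

lemma matrix_mult_minus_left: "(- A) ** C = - (A ** (C :: real^'k^'n))" for A :: "real^'n^'m"
  by (simp add: matrix_matrix_mult_def vec_eq_iff sum_negf)

lemma matrix_vector_mult_minus_left: "(- A) *v x = - (A *v (x :: real^'n))" for A :: "real^'n^'m"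
  by (simp add: matrix_vector_mult_def vec_eq_iff sum_negf)

lemma matrix_vector_mult_minus_right: "A *v (- x) = - (A *v (x :: real^'n))" for A :: "real^'n^'m"
  by (simp add: matrix_vector_mult_def vec_eq_iff sum_negf)

text \<open>
  The resolvent identity \<open>(I + S P)\<^sup>-\<^sup>1 S = B W\<^sup>-\<^sup>1 B'\<close> comes from \<open>(I + S P) B = B R\<^sup>-\<^sup>1 W\<close>. For invertibility of
  \<open>I + S P\<close>: a kernel vector is \<open>v = - B y\<close> with \<open>R y = B' P v\<close>, hence \<open>y \<bullet> R y = - v \<bullet> P v \<le> 0\<close> and \<open>y = 0\<close>.
\<close>
lemma feedback_identities:
  fixes P :: "real^'n^'n" and B :: "real^'m^'n" and R :: "real^'m^'m"
  assumes R: "symmetric_matrix R" "pos_definite R" and P: "symmetric_matrix P" "nonneg_definite P"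
  defines "S \<equiv> B ** matrix_inv R ** transpose B" and "W \<equiv> transpose B ** P ** B + R"
  shows "invertible (mat 1 + S ** P)"
    and "matrix_inv (mat 1 + S ** P) ** S = B ** matrix_inv W ** transpose B"
    and "transpose (matrix_inv W) = matrix_inv W"
proof -
  have R_inv: "invertible R"
  proof (rule invertible_of_trivial_kernel)
    fix v assume "R *v v = 0"
    then show "v = 0" using R(2) unfolding pos_definite_def by (metis inner_zero_right less_irrefl)
  qed
  note RI = matrix_inv_mult[OF R_inv]
  have W_inv: "invertible W"
  proof (rule invertible_of_trivial_kernel)
    fix v assume v: "W *v v = 0"
    show "v = 0"
    proof (rule ccontr)
      assume "v \<noteq> 0"
      then have "0 < v \<bullet> (R *v v)" using R(2) by (simp add: pos_definite_def)
      moreover have "0 \<le> v \<bullet> (transpose B *v (P *v (B *v v)))"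
        unfolding inner_transpose using P(2) by (simp add: nonneg_definite_def)
      moreover have "W *v v = transpose B *v (P *v (B *v v)) + R *v v"
        by (simp add: W_def matrix_vector_mult_add_rdistrib matrix_vector_mul_assoc matrix_mul_assoc)
      ultimately show False using v by (metis add_nonneg_pos inner_add_right inner_zero_right less_irrefl)
    qed
  qed
  note WI = matrix_inv_mult[OF W_inv]
  show inv: "invertible (mat 1 + S ** P)"
  proof (rule invertible_of_trivial_kernel)
    fix v assume "(mat 1 + S ** P) *v v = 0"
    define y where "y = matrix_inv R *v (transpose B *v (P *v v))"
    have "v + S *v (P *v v) = 0"
      using \<open>(mat 1 + S ** P) *v v = 0\<close>
      by (simp add: matrix_vector_mult_add_rdistrib matrix_vector_mul_assoc matrix_mul_assoc)
    moreover have S: "S *v (P *v v) = B *v y" by (simp add: S_def y_def matrix_vector_mul_assoc matrix_mul_assoc)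
    ultimately have v: "v = - (B *v y)" by (simp add: eq_neg_iff_add_eq_0)
    have Ry: "R *v y = transpose B *v (P *v v)"
      by (simp add: y_def matrix_vector_mul_assoc RI matrix_mul_assoc)
    have "y \<bullet> (R *v y) = (B *v y) \<bullet> (P *v v)" unfolding Ry by (rule inner_transpose)
    also have "\<dots> = - (v \<bullet> (P *v v))" by (subst (2) v) simp
    also have "\<dots> \<le> 0" using P(2) by (simp add: nonneg_definite_def)
    finally have "y = 0" using R(2) unfolding pos_definite_def by (meson not_less)
    then show "v = 0" using v by simp
  qed
  note I = matrix_inv_mult[OF inv]
  have "(mat 1 + S ** P) ** (B ** matrix_inv W) = B ** matrix_inv R"
  proof -
    have "(mat 1 + S ** P) ** B = B + B ** matrix_inv R ** (transpose B ** P ** B)"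
      by (simp add: S_def matrix_mult_add_rdistrib matrix_mul_assoc)
    also have "\<dots> = B ** matrix_inv R ** R + B ** matrix_inv R ** (transpose B ** P ** B)"
      by (simp add: RI flip: matrix_mul_assoc)
    also have "\<dots> = B ** matrix_inv R ** W" by (simp add: W_def matrix_add_ldistrib add.commute)
    finally have "(mat 1 + S ** P) ** B = B ** matrix_inv R ** W" .
    then have "(mat 1 + S ** P) ** B ** matrix_inv W = B ** matrix_inv R ** (W ** matrix_inv W)"
      by (simp add: matrix_mul_assoc)
    then show ?thesis by (simp add: WI matrix_mul_assoc)
  qed
  then have "matrix_inv (mat 1 + S ** P) ** ((mat 1 + S ** P) ** (B ** matrix_inv W)) ** transpose B
      = matrix_inv (mat 1 + S ** P) ** S"
    by (simp add: S_def matrix_mul_assoc)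
  then show "matrix_inv (mat 1 + S ** P) ** S = B ** matrix_inv W ** transpose B"
    by (simp add: I matrix_mul_assoc)
  have "transpose W = W"
    using R(1) P(1)
    by (simp add: W_def symmetric_matrix_def matrix_transpose_mul matrix_mul_assoc transpose_add)
  then have "transpose (matrix_inv W) ** W = mat 1"
    using WI(1) by (metis matrix_transpose_mul transpose_mat)
  then show "transpose (matrix_inv W) = matrix_inv W"
    using WI(1) by (metis matrix_mul_assoc matrix_mul_lid matrix_mul_rid)
qed

section \<open>The local stable manifold of the Hamiltonian dynamics\<close>

theorem theorem4p1:
  fixes A Q P :: "real^'n^'n"
    and B :: "real^'m^'n"
    and R :: "real^'m^'m"
    and K :: "real^'n^'m"
    and F G :: "(real^'n) \<times> (real^'n) \<Rightarrow> real^'n"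
    and r :: nat
  assumes r: "r \<ge> 1"
    and A_sing: "eigenvalue A 0"
    and Q: "symmetric_matrix Q" "nonneg_definite Q"
    and R: "symmetric_matrix R" "pos_definite R"
    and P: "symmetric_matrix P" "nonneg_definite P"
    and riccati:
      "P - transpose A ** P ** A
         + transpose A ** P ** B ** matrix_inv (transpose B ** P ** B + R) ** transpose B ** P ** A
         - Q = 0"
    and K: "K = - (matrix_inv (transpose B ** P ** B + R) ** transpose B ** P ** A)"
    and hyperbolic: "eigenvalues_in_unit_disc (A + B ** K)"
    and F: "Cr_on r UNIV F" "F (0, 0) = 0" "(F has_derivative (\<lambda>_. 0)) (at (0, 0))"
    and G: "Cr_on r UNIV G" "G (0, 0) = 0" "(G has_derivative (\<lambda>_. 0)) (at (0, 0))"
  shows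
    "(\<forall>U \<psi>. open U \<and> 0 \<in> U \<and> Cr_on r U \<psi> \<and> \<psi> 0 = 0 \<and> (\<psi> has_derivative (\<lambda>_. 0)) (at 0) \<longrightarrow>
        (\<exists>W. open W \<and> (0, 0) \<in> W \<and>
           Cr_on r W (f_term B R P F \<psi>) \<and> Cr_on r W (h_term A B R P K F G \<psi>)) \<and>
        f_term B R P F \<psi> (0, 0) = 0 \<and> h_term A B R P K F G \<psi> (0, 0) = 0 \<and>
        (f_term B R P F \<psi> has_derivative (\<lambda>_. 0)) (at (0, 0)) \<and>
        (h_term A B R P K F G \<psi> has_derivative (\<lambda>_. 0)) (at (0, 0))) \<and>
     (\<exists>U \<psi>. open U \<and> 0 \<in> U \<and> Cr_on r U \<psi> \<and> \<psi> 0 = 0 \<and> (\<psi> has_derivative (\<lambda>_. 0)) (at 0) \<and>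
        local_stable_manifold (A + B ** K)
          (f_term B R P F \<psi>) (h_term A B R P K F G \<psi>) U \<psi>)"
proof -
  define S where "S = B ** matrix_inv R ** transpose B"
  define M where "M = matrix_inv (mat 1 + S ** P)"
  define N where "N = transpose A ** P"
  define T where "T = transpose K ** transpose B"
  define L where "L = A + B ** K"
  define q :: "(real^'n \<Rightarrow> real^'n) \<Rightarrow> (real^'n) \<times> (real^'n) \<Rightarrow> (real^'n) \<times> (real^'n)"
    where "q \<psi> = (\<lambda>z. (fst z, P *v snd z + \<psi> (snd z)))" for \<psi>
  note ids = feedback_identities[OF R P, of B, folded S_def, folded M_def]
  \<comment> \<open>The feedback gain expressed through \<open>M S\<close>; this produces the cancellation in \<open>h\<close> below.\<close>
  have T: "T = - (N ** (M ** S))"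
    using P(1) ids(3) unfolding T_def K N_def ids(2)
    by (simp add: symmetric_matrix_def matrix_transpose_mul matrix_mul_assoc transpose_minus matrix_mult_minus_left)
  have LP: "transpose L ** P = N + T ** P"
    by (simp add: L_def T_def N_def transpose_add matrix_transpose_mul matrix_mult_add_rdistrib)
  have f: "f_term B R P F \<psi> z = M *v F (q \<psi> z) - (M ** S) *v \<psi> (snd z)" for \<psi> z
    by (cases z) (simp add: f_term_def q_def matrix_vector_mult_diff_distrib matrix_vector_mul_assoc
        flip: S_def M_def)
  have h: "h_term A B R P K F G \<psi> z = (N ** M) *v F (q \<psi> z) + G (q \<psi> z)" for \<psi> z
  proof -
    let ?f = "f_term B R P F \<psi> z"
    have "h_term A B R P K F G \<psi> z
        = (transpose L ** P) *v ?f + (G (q \<psi> z) + T *v (- \<psi> (snd z) - P *v ?f))"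
      by (cases z) (simp add: h_term_def g_term_def q_def L_def T_def)
    also have "\<dots> = N *v ?f - T *v \<psi> (snd z) + G (q \<psi> z)"
      unfolding LP by (simp add: matrix_vector_mult_add_rdistrib matrix_vector_mult_diff_distrib
          matrix_vector_mul_assoc matrix_vector_mult_minus_right)
    also have "\<dots> = (N ** M) *v F (q \<psi> z) + G (q \<psi> z)"
      unfolding f T by (simp add: matrix_vector_mult_diff_distrib matrix_vector_mul_assoc
          matrix_vector_mult_minus_left)
    finally show ?thesis .
  qed
  have nonlinear_terms: "(\<exists>W. open W \<and> (0, 0) \<in> W \<and>
           Cr_on r W (f_term B R P F \<psi>) \<and> Cr_on r W (h_term A B R P K F G \<psi>)) \<and>
        f_term B R P F \<psi> (0, 0) = 0 \<and> h_term A B R P K F G \<psi> (0, 0) = 0 \<and>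
        (f_term B R P F \<psi> has_derivative (\<lambda>_. 0)) (at (0, 0)) \<and>
        (h_term A B R P K F G \<psi> has_derivative (\<lambda>_. 0)) (at (0, 0))"
    if "open U" "0 \<in> U" "Cr_on r U \<psi>" "\<psi> 0 = 0" "(\<psi> has_derivative (\<lambda>_. 0)) (at 0)" for U \<psi>
  proof -
    define W :: "((real^'n) \<times> (real^'n)) set" where "W = snd -` U"
    have W: "open W" "(0, 0) \<in> W"
      unfolding W_def using that(1,2) by (auto intro: open_vimage_snd)
    have \<psi>: "Ck_on r W (\<lambda>z. \<psi> (snd z))"
      unfolding W_def using that(3) unfolding Cr_on_eq_Ck_on
      by (intro Ck_on_precompose_linear that(1) bounded_linear_snd)
    have qW: "Ck_on r W (q \<psi>)" unfolding q_def
      by (intro Ck_on_Pair Ck_on_add W(1) \<psi> Ck_on_bounded_linear bounded_linear_fst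
          bounded_linear_compose[OF matrix_vector_mul_bounded_linear bounded_linear_snd])
    note FG = F(1)[unfolded Cr_on_eq_Ck_on] G(1)[unfolded Cr_on_eq_Ck_on]
    have Cf: "Ck_on r W (\<lambda>z. M *v F (q \<psi> z) + - ((M ** S) *v \<psi> (snd z)))"
      by (intro Ck_on_add W(1) Ck_on_linear_compose[OF matrix_vector_mul_bounded_linear]
          Ck_on_linear_compose[OF bounded_linear_minus[OF matrix_vector_mul_bounded_linear]]
          Ck_on_compose[OF W(1) FG(1) qW] \<psi>)
    have Ch: "Ck_on r W (\<lambda>z. (N ** M) *v F (q \<psi> z) + G (q \<psi> z))"
      by (intro Ck_on_add W(1) Ck_on_linear_compose[OF matrix_vector_mul_bounded_linear]
          Ck_on_compose[OF W(1) FG(1) qW] Ck_on_compose[OF W(1) FG(2) qW])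
    have q0: "q \<psi> (0, 0) = (0, 0)" by (simp add: q_def that(4))
    have snd': "(snd has_derivative snd) (at (0 :: real^'n, 0 :: real^'n))"
      by (rule bounded_linear_imp_has_derivative[OF bounded_linear_snd])
    have d\<psi>: "((\<lambda>z :: (real^'n) \<times> (real^'n). \<psi> (snd z)) has_derivative (\<lambda>_. 0)) (at (0, 0))"
      using diff_chain_at[OF snd', of \<psi> "\<lambda>_. 0"] that(5) by (simp add: o_def)
    have dq: "(q \<psi> has_derivative (\<lambda>z. (fst z, P *v snd z + 0))) (at (0, 0))"
      unfolding q_def
      by (intro has_derivative_Pair has_derivative_add d\<psi>
          bounded_linear_imp_has_derivative bounded_linear_fst
          bounded_linear_compose[OF matrix_vector_mul_bounded_linear bounded_linear_snd])
    have dF: "((\<lambda>z. F (q \<psi> z)) has_derivative (\<lambda>_. 0)) (at (0, 0))"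
      using diff_chain_at[OF dq, of F "\<lambda>_. 0"] F(3) by (simp add: q0 o_def)
    have dG: "((\<lambda>z. G (q \<psi> z)) has_derivative (\<lambda>_. 0)) (at (0, 0))"
      using diff_chain_at[OF dq, of G "\<lambda>_. 0"] G(3) by (simp add: q0 o_def)
    note lin = bounded_linear.has_derivative[OF matrix_vector_mul_bounded_linear]
    have "(f_term B R P F \<psi> has_derivative (\<lambda>_. 0)) (at (0, 0))"
      using has_derivative_diff[OF lin[OF dF, of M] lin[OF d\<psi>, of "M ** S"]]
      by (simp add: f[abs_def])
    moreover have "(h_term A B R P K F G \<psi> has_derivative (\<lambda>_. 0)) (at (0, 0))"
      using has_derivative_add[OF lin[OF dF, of "N ** M"] dG] by (simp add: h[abs_def])
    ultimately show ?thesis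
      using W Cf Ch F(2) G(2) that(4) unfolding Cr_on_eq_Ck_on
      by (auto simp: f h q0 f[abs_def] h[abs_def])
  qed
  have summable: "summable_powers ((*v) L)"
    using hyperbolic summable_powers_matrix unfolding L_def by blast
  define \<phi> where "\<phi> z = (F z, G z)" for z
  have \<phi>: "Ck_on r UNIV \<phi>" "\<phi> 0 = 0" "(\<phi> has_derivative (\<lambda>_. 0)) (at 0)"
    using F G has_derivative_Pair[of F "\<lambda>_. 0" "0" UNIV G "\<lambda>_. 0"] unfolding \<phi>_def Cr_on_eq_Ck_on
    by (auto intro!: Ck_on_Pair simp: zero_prod_def)
  note mvb = matrix_vector_mul_bounded_linear
  obtain \<rho> \<sigma> \<psi> where \<rho>: "\<rho> > 0" "\<sigma> > 0" "\<sigma> \<le> \<rho>"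
    and \<psi>: "Ck_on r (ball 0 \<rho>) \<psi>" "\<psi> 0 = 0" "(\<psi> has_derivative (\<lambda>_. 0)) (at 0)"
    and traj: "\<And>p. p \<in> ball 0 \<sigma> \<Longrightarrow> \<exists>x. x 0 = p \<and> (\<forall>k. x k \<in> ball 0 \<rho>) \<and> x \<longlonglongrightarrow> 0 \<and>
      (\<forall>k. x (Suc k) = L *v x k + M *v fst (\<phi> (x k, P *v x (Suc k) + \<psi> (x (Suc k))))
             - (M ** S) *v \<psi> (x (Suc k)) \<and>
           \<psi> (x k) = transpose L *v \<psi> (x (Suc k)) +
             ((N ** M) *v fst (\<phi> (x k, P *v x (Suc k) + \<psi> (x (Suc k))))
              + snd (\<phi> (x k, P *v x (Suc k) + \<psi> (x (Suc k))))))"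
    by (rule stable_manifold_of_split_system[OF summable summable_powers_transpose[OF summable]
          mvb[of P] mvb[of "M ** S"] bounded_linear_compose[OF mvb[of M] bounded_linear_fst]
          bounded_linear_add[OF bounded_linear_compose[OF mvb[of "N ** M"] bounded_linear_fst]
            bounded_linear_snd] \<phi>(1) r \<phi>(2,3)]) (rule that; assumption)
  have "local_stable_manifold L (f_term B R P F \<psi>) (h_term A B R P K F G \<psi>) (ball 0 \<rho>) \<psi>"
    unfolding local_stable_manifold_def
  proof (intro conjI exI[of _ "ball 0 \<sigma>"] ballI)
    fix p :: "real^'n" assume "p \<in> ball 0 \<sigma>"
    from traj[OF this] obtain x where x: "x 0 = p" "\<And>k. x k \<in> ball 0 \<rho>" "x \<longlonglongrightarrow> 0"
      and step: "\<And>k. x (Suc k) = L *v x k + M *v fst (\<phi> (x k, P *v x (Suc k) + \<psi> (x (Suc k))))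
             - (M ** S) *v \<psi> (x (Suc k))"
        "\<And>k. \<psi> (x k) = transpose L *v \<psi> (x (Suc k)) +
             ((N ** M) *v fst (\<phi> (x k, P *v x (Suc k) + \<psi> (x (Suc k))))
              + snd (\<phi> (x k, P *v x (Suc k) + \<psi> (x (Suc k)))))" by blast
    have "isCont \<psi> 0" using \<psi>(3) by (rule has_derivative_continuous)
    then have "(\<lambda>k. \<psi> (x k)) \<longlonglongrightarrow> 0" using isCont_tendsto_compose[OF _ x(3), of \<psi>] \<psi>(2) by simp
    then have lim: "(\<lambda>k. (x k, \<psi> (x k))) \<longlonglongrightarrow> (0, 0)" by (rule tendsto_Pair[OF x(3)])
    have eq1: "x (Suc k) = L *v x k + f_term B R P F \<psi> (x k, x (Suc k))" for k
      unfolding f q_def fst_conv snd_conv using step(1)[of k] by (simp only: \<phi>_def fst_conv add_diff_eq)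
    have eq2: "\<psi> (x k) = transpose L *v \<psi> (x (Suc k)) + h_term A B R P K F G \<psi> (x k, x (Suc k))" for k
      unfolding h q_def fst_conv snd_conv using step(2)[of k] by (simp only: \<phi>_def fst_conv snd_conv)
    show "\<exists>x. x 0 = p \<and> (\<forall>k. x k \<in> ball 0 \<rho>) \<and>
        (\<forall>k. x (Suc k) = L *v x k + f_term B R P F \<psi> (x k, x (Suc k)) \<and>
             \<psi> (x k) = transpose L *v \<psi> (x (Suc k)) + h_term A B R P K F G \<psi> (x k, x (Suc k))) \<and>
        (\<lambda>k. (x k, \<psi> (x k))) \<longlonglongrightarrow> (0, 0)"
      using x(1,2) eq1 eq2 lim by blast
  qed (use \<rho> \<psi>(2) in auto)
  then have "\<exists>U \<psi>. open U \<and> 0 \<in> U \<and> Cr_on r U \<psi> \<and> \<psi> 0 = 0 \<and> (\<psi> has_derivative (\<lambda>_. 0)) (at 0) \<and>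
        local_stable_manifold (A + B ** K)
          (f_term B R P F \<psi>) (h_term A B R P K F G \<psi>) U \<psi>"
    using \<rho>(1) \<psi> unfolding Cr_on_eq_Ck_on L_def
    by (intro exI[of _ "ball 0 \<rho>"] exI[of _ \<psi>]) simp
  with nonlinear_terms show ?thesis by blast
qed

end
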